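(* Let $p\geq 3$ be a prime, let $\lambda\in\mathbb{C}_p$ be not a root of unity with $1/p<|1-\lambda|<1$, and let $$f(x)=\lambda x+\sum_{i=2}^{\infty}a_ix^i\in\mathcal{O}_p[[x]],\qquad |a_2|=1 \text{ and } |a_2^2-a_3|=1.$$ Then the boundary $\partial\Delta_f:=\{x\in\mathbb{C}_p:|x|=r(f)\}$ of the linearization disk $\Delta_f$ of $f$ does not contain any periodic point of $f$.
   Context: $\mathbb{C}_p$ is the completion of an algebraic closure of $\mathbb{Q}_p$, with absolute value normalized by $|p|=1/p$; $\mathcal{O}_p=\{x\in\mathbb{C}_p:|x|\le 1\}$. The linearization disk $\Delta_f$ of $f$ is the maximal disk about the origin on which $f$ is analytically conjugate to $T_\lambda:x\mapsto\lambda x$ (via the power series $H_f$ with $H_f(0)=0$, $H_f'(0)=1$, $H_f\circ f=\lambda H_f$), and $r(f)$ denotes its exact radius. A periodic point of $f$ is a point $x$ with $f^{n}(x)=x$ for some $n\ge1$, where $f^n$ is the $n$-th iterate. *)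

theory Defs
  imports "HOL-Analysis.Analysis" "HOL-Computational_Algebra.Computational_Algebra"
begin

section \<open>The field of complex p-adic numbers\<close>

text \<open>
  Fields of characteristic zero with a non-archimedean absolute value, which induces the metric and
  the topology. (A p-adic field is not a real vector space, and the constant \<open>norm\<close> of the library
  is constrained to \<open>real_normed_vector\<close>.)
\<close>

class ultrametric_field = field_char_0 + metric_space +
  fixes vabs :: "'a \<Rightarrow> real"
  assumes dist_vabs: "dist x y = vabs (x - y)"
    and vabs_times: "vabs (x * y) = vabs x * vabs y"
    and vabs_plus_le_max: "vabs (x + y) \<le> max (vabs x) (vabs y)"

text \<open>The absolute value on the rationals with \<open>padic_abs p (rat_of_nat p) = 1 / p\<close>.\<close>

definition padic_abs :: "nat \<Rightarrow> rat \<Rightarrow> real" where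
  "padic_abs p q = (if q = 0 then 0 else
     real p powi (int (multiplicity (int p) (snd (quotient_of q)))
                  - int (multiplicity (int p) (fst (quotient_of q)))))"

text \<open>
  In a complete field whose absolute value extends \<open>padic_abs p\<close>, the closure of the prime field is
  the completion \<open>\<rat>\<^sub>p\<close> of the rationals.
\<close>

definition rat_completion :: "'a :: {ultrametric_field, complete_space} set" where
  "rat_completion = closure (range of_rat)"

definition algebraic_over :: "'a :: field set \<Rightarrow> 'a \<Rightarrow> bool" where
  "algebraic_over F x \<longleftrightarrow> (\<exists>q. q \<noteq> 0 \<and> (\<forall>i. coeff q i \<in> F) \<and> poly q x = 0)"

definition is_algebraic_closure :: "'a :: field set \<Rightarrow> 'a set \<Rightarrow> bool" where
  "is_algebraic_closure F L \<longleftrightarrow>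
     F \<subseteq> L \<and> 1 \<in> L \<and>
     (\<forall>x\<in>L. \<forall>y\<in>L. x - y \<in> L \<and> x * y \<in> L \<and> inverse x \<in> L) \<and>
     (\<forall>x\<in>L. algebraic_over F x) \<and>
     (\<forall>q. (\<forall>i. coeff q i \<in> L) \<and> degree q > 0 \<longrightarrow> (\<exists>x\<in>L. poly q x = 0))"

text \<open>
  The type \<open>'a\<close> is a model of \<open>\<complex>\<^sub>p\<close>: it is complete (by its sort) and contains, as a dense subfield,
  an algebraic closure of \<open>\<rat>\<^sub>p\<close>. This determines \<open>'a\<close> up to isometric isomorphism, because
  the absolute value on \<open>\<rat>\<^sub>p\<close> extends uniquely to an algebraic closure.
\<close>

definition is_padic_complex :: "nat \<Rightarrow> 'a :: {ultrametric_field, complete_space} itself \<Rightarrow> bool" where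
  "is_padic_complex p K \<longleftrightarrow>
     prime p \<and>
     (\<forall>q. vabs (of_rat q :: 'a) = padic_abs p q) \<and>
     (\<exists>L :: 'a set. is_algebraic_closure rat_completion L \<and> closure L = UNIV)"

definition integer_ring :: "'a :: ultrametric_field set" where
  "integer_ring = {x. vabs x \<le> 1}"


section \<open>Power series as functions\<close>

text \<open>\<open>eval_fps\<close> of the library is restricted to real normed algebras.\<close>

definition converges_at :: "'a :: ultrametric_field fps \<Rightarrow> 'a \<Rightarrow> bool" where
  "converges_at g x \<longleftrightarrow> summable (\<lambda>n. fps_nth g n * x ^ n)"

definition fps_value :: "'a :: ultrametric_field fps \<Rightarrow> 'a \<Rightarrow> 'a" where
  "fps_value g x = (\<Sum>n. fps_nth g n * x ^ n)"

text \<open>All iterates up to the period have to be defined, i.e. the orbit stays where \<open>f\<close> converges.\<close>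

definition periodic_point :: "'a :: ultrametric_field fps \<Rightarrow> 'a \<Rightarrow> bool" where
  "periodic_point f x \<longleftrightarrow>
     (\<exists>n\<ge>1. (\<forall>k<n. converges_at f ((fps_value f ^^ k) x)) \<and> (fps_value f ^^ n) x = x)"


section \<open>Linearization disks\<close>

definition is_linearization :: "'a :: field fps \<Rightarrow> 'a fps \<Rightarrow> bool" where
  "is_linearization f H \<longleftrightarrow>
     fps_nth H 0 = 0 \<and> fps_nth H 1 = 1 \<and> H oo f = fps_const (fps_nth f 1) * H"

definition linearization :: "'a :: field fps \<Rightarrow> 'a fps" where
  "linearization f = (THE H. is_linearization f H)"

lemma is_linearization_coeff:
  fixes f :: "'a :: field fps"
  assumes f0: "fps_nth f 0 = 0"
  shows "fps_nth (H oo f) n = fps_nth (fps_const (fps_nth f 1) * H) n \<longleftrightarrow>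
         (\<Sum>i<n. fps_nth H i * fps_nth (f ^ i) n) = (fps_nth f 1 - fps_nth f 1 ^ n) * fps_nth H n"
proof -
  have "fps_nth (H oo f) n = (\<Sum>i\<in>insert n {..<n}. fps_nth H i * fps_nth (f ^ i) n)"
    unfolding fps_compose_nth by (rule sum.cong) auto
  also have "\<dots> = fps_nth H n * fps_nth f 1 ^ n + (\<Sum>i<n. fps_nth H i * fps_nth (f ^ i) n)"
    using startsby_zero_power_nth_same[OF f0, of n] by simp
  finally show ?thesis by (auto simp: algebra_simps)
qed

text \<open>The formal conjugacy is unique and exists, so that \<open>linearization f\<close> is well-defined.\<close>

lemma ex1_linearization:
  fixes f :: "'a :: field fps"
  assumes f0: "fps_nth f 0 = 0" and nz: "fps_nth f 1 \<noteq> 0"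
    and not_root: "\<And>n. n \<ge> 1 \<Longrightarrow> fps_nth f 1 ^ n \<noteq> 1"
  shows "\<exists>!H. is_linearization f H"
proof -
  define l where "l = fps_nth f 1"
  have ne: "l - l ^ n \<noteq> 0" if "n \<ge> 2" for n
  proof
    assume "l - l ^ n = 0"
    then have "l * 1 = l * l ^ (n - 1)"
      using that by (simp flip: power_Suc)
    then have "l ^ (n - 1) = 1"
      using nz unfolding l_def by (metis mult_left_cancel)
    then show False
      using not_root[of "n - 1"] that unfolding l_def by linarith
  qed
  define step where "step = (\<lambda>g n. if n = 0 then 0 else if n = 1 then 1
      else (\<Sum>i<n. g i * fps_nth (f ^ i) n) / (l - l ^ n))"
  define c where "c = wfrec less_than step"
  have c: "c n = step c n" for n
  proof -
    have "c n = step (cut c less_than n) n"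
      unfolding c_def by (rule wfrec) simp
    also have "\<dots> = step c n"
      unfolding step_def by (auto simp: cut_apply intro!: sum.cong)
    finally show ?thesis .
  qed
  have iff: "is_linearization f H \<longleftrightarrow> (\<forall>n. fps_nth H n = step (fps_nth H) n)" for H
  proof
    assume H: "is_linearization f H"
    show "\<forall>n. fps_nth H n = step (fps_nth H) n"
    proof
      fix n
      have "(\<Sum>i<n. fps_nth H i * fps_nth (f ^ i) n) = (l - l ^ n) * fps_nth H n"
        using H is_linearization_coeff[OF f0, of H n]
        unfolding is_linearization_def l_def by simp
      then show "fps_nth H n = step (fps_nth H) n"
        using H ne[of n] unfolding step_def is_linearization_def by auto
    qed
  next
    assume H: "\<forall>n. fps_nth H n = step (fps_nth H) n"
    have H0: "fps_nth H 0 = 0" and H1: "fps_nth H 1 = 1"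
      using H[rule_format, of 0] H[rule_format, of 1] by (simp_all add: step_def)
    have "(\<Sum>i<n. fps_nth H i * fps_nth (f ^ i) n) = (l - l ^ n) * fps_nth H n" for n
    proof (cases "n \<ge> 2")
      case True
      then have "fps_nth H n = (\<Sum>i<n. fps_nth H i * fps_nth (f ^ i) n) / (l - l ^ n)"
        using H[rule_format, of n] by (simp add: step_def)
      then show ?thesis using ne[OF True] by simp
    next
      case False
      then have "n = 0 \<or> n = 1" by auto
      then show ?thesis using H0 by auto
    qed
    then have "H oo f = fps_const (fps_nth f 1) * H"
      unfolding fps_eq_iff is_linearization_coeff[OF f0] l_def by blast
    then show "is_linearization f H"
      using H0 H1 unfolding is_linearization_def by simp
  qed
  show ?thesis
  proof (rule ex1I[of _ "Abs_fps c"])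
    have "fps_nth (Abs_fps c) = c" by (simp add: fun_eq_iff)
    then show "is_linearization f (Abs_fps c)"
      unfolding iff using c by simp
  next
    fix H assume "is_linearization f H"
    then have H: "fps_nth H n = step (fps_nth H) n" for n
      unfolding iff by blast
    have "fps_nth H n = c n" for n
    proof (induction n rule: less_induct)
      case (less n)
      have "step (fps_nth H) n = step c n"
        unfolding step_def using less by (auto intro!: sum.cong)
      then show ?case using H[of n] c[of n] by simp
    qed
    then show "H = Abs_fps c" by (simp add: fps_eq_iff)
  qed
qed

text \<open>
  \<open>H\<close> is an analytic bijection from \<open>U\<close> onto its image, with analytic inverse given by the
  compositional inverse series, and it conjugates the map \<open>f\<close> on \<open>U\<close> to multiplication by \<open>f'(0)\<close>.
\<close>

definition conjugate_to_linear_on :: "'a :: ultrametric_field fps \<Rightarrow> 'a set \<Rightarrow> bool" where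
  "conjugate_to_linear_on f U \<longleftrightarrow>
     (let H = linearization f in
      \<forall>x\<in>U. converges_at f x \<and> fps_value f x \<in> U \<and>
            converges_at H x \<and> fps_value H (fps_value f x) = fps_nth f 1 * fps_value H x \<and>
            converges_at (fps_inv H) (fps_value H x) \<and>
            fps_value (fps_inv H) (fps_value H x) = x)"

text \<open>Open and closed disks are both admitted: they are different sets if the radius is the absolute value of an element.\<close>

definition disk_about_zero :: "'a :: ultrametric_field set \<Rightarrow> bool" where
  "disk_about_zero U \<longleftrightarrow> (\<exists>r>0. U = ball 0 r \<or> U = cball 0 r)"

text \<open>
  Disks about the origin form a chain, so their union is the maximal one.
\<close>

definition linearization_disk :: "'a :: ultrametric_field fps \<Rightarrow> 'a set" where
  "linearization_disk f = \<Union>{U. disk_about_zero U \<and> conjugate_to_linear_on f U}"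

lemma conjugate_on_linearization_disk: "conjugate_to_linear_on f (linearization_disk f)"
  unfolding linearization_disk_def conjugate_to_linear_on_def Let_def by blast

lemma linearization_disk_greatest:
  "disk_about_zero U \<Longrightarrow> conjugate_to_linear_on f U \<Longrightarrow> U \<subseteq> linearization_disk f"
  unfolding linearization_disk_def by blast

text \<open>
  Over \<open>\<complex>\<^sub>p\<close> the set of absolute values is dense in \<open>[0, \<infinity>)\<close>, so the radius of a disk, open or
  closed, is recovered as the supremum of the absolute values of its elements.
\<close>

definition linearization_radius :: "'a :: ultrametric_field fps \<Rightarrow> real" where
  "linearization_radius f = (SUP x\<in>linearization_disk f. vabs x)"

definition linearization_boundary :: "'a :: ultrametric_field fps \<Rightarrow> 'a set" where
  "linearization_boundary f = {x. vabs x = linearization_radius f}"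

end

theory Submission
  imports Defs
begin

text \<open>
  Let \<open>\<lambda>\<close> be the multiplier of \<open>f\<close>, \<open>\<epsilon> = \<bar>1 - \<lambda>\<bar>\<close>, \<open>H\<close> the linearization with coefficients \<open>b\<^sub>k\<close>,
  and \<open>r\<close> the radius of the linearization disk. Three facts about \<open>r\<close> and \<open>H\<close> and one obstruction
  in the residue field give the theorem.

  The radius is positive. The numbers \<open>\<bar>1 - \<lambda>\<^sup>n\<bar>\<close> are at least a constant times \<open>\<bar>n\<bar>\<close>, so the small
  denominators in the recurrence for \<open>b\<^sub>k\<close> multiply up to an exponential only
  (\<open>linearization_coeff_exponential_bound\<close>).

  On the disk \<open>H\<close> is injective with inverse given by a power series, and this forces
  \<open>\<bar>b\<^sub>k\<bar> \<bar>x\<bar>\<^bsup>k-1\<^esup> \<le> 1\<close> there (\<open>linearization_coeff_le_on_disk\<close>), hence also for \<open>\<bar>x\<bar> = r\<close>.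

  The radius is less than \<open>\<epsilon>\<close>. Under the hypotheses on \<open>a\<^sub>2\<close> and \<open>a\<^sub>3\<close> the absolute value of
  \<open>b\<^bsub>p+1\<^esub>\<close> can be read off from the recurrence: it is \<open>\<epsilon>\<^bsup>-(p-2)\<^esup> / \<bar>1 - \<lambda>\<^sup>p\<bar>\<close>. This exceeds
  \<open>\<epsilon>\<^bsup>-p\<^esup>\<close> because \<open>\<bar>1 - \<lambda>\<^sup>p\<bar> < \<epsilon>\<^sup>2\<close> for \<open>1 / p < \<epsilon> < 1\<close> (\<open>vabs_linearization_coeff_p_gt\<close>), and the
  previous bound with \<open>k = p + 1\<close> gives \<open>r < \<epsilon>\<close>.

  Now let \<open>x\<close> be a periodic point with \<open>\<bar>x\<bar> = r\<close>, of period \<open>m\<close>. It is not fixed, since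
  \<open>f x - x\<close> has absolute value \<open>\<epsilon> \<bar>x\<bar>\<close> for \<open>0 < \<bar>x\<bar> < \<epsilon>\<close>. Choose the coordinate in which \<open>x\<close> is \<open>1\<close>.
  There the linearization \<open>h\<close> has integral coefficients, so the \<open>m\<close>-th iterate, which \<open>h\<close>
  conjugates to multiplication by \<open>\<Lambda> = \<lambda>\<^sup>m\<close>, is \<open>X + (\<Lambda> - 1) X V\<close> with integral \<open>V\<close>. Both \<open>1\<close> and
  the image of \<open>1\<close> under \<open>f\<close> are zeros of \<open>V\<close>, and they are congruent: over the residue field \<open>V\<close> is
  a polynomial with a double zero. On the other hand, the first-order part of the conjugacy equation
  is \<open>h = V X h'\<close> over the residue field, so \<open>dX / (X V)\<close> is the logarithmic differential \<open>dh / h\<close>.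
  In characteristic \<open>p\<close> a logarithmic differential is fixed by the Cartier operator and has simple
  poles only, so \<open>V\<close> has no double zero. In elementary terms, the coefficients of \<open>V\<^bsup>p-1\<^esup>\<close> in the
  degrees divisible by \<open>p\<close> are those of \<open>1\<close> (\<open>logarithmic_derivative_coeffs\<close>), and this is
  impossible if \<open>(X - 1)\<^sup>2\<close> divides \<open>V\<close> (\<open>no_double_zero\<close>).
\<close>

section \<open>The absolute value\<close>

lemma vabs_nonneg [simp]: "0 \<le> vabs (x :: 'a :: ultrametric_field)"
  using dist_vabs[of x 0] by (metis diff_zero zero_le_dist)

lemma vabs_eq_0_iff [simp]: "vabs (x :: 'a :: ultrametric_field) = 0 \<longleftrightarrow> x = 0"
  using dist_vabs[of x 0] by (metis diff_zero dist_eq_0_iff)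

lemma vabs_0 [simp]: "vabs (0 :: 'a :: ultrametric_field) = 0"
  by simp

lemma vabs_pos_iff [simp]: "0 < vabs (x :: 'a :: ultrametric_field) \<longleftrightarrow> x \<noteq> 0"
  using vabs_nonneg[of x] vabs_eq_0_iff[of x] by linarith

lemma vabs_1 [simp]: "vabs (1 :: 'a :: ultrametric_field) = 1"
  using vabs_times[of "1::'a" 1] by (metis mult_cancel_left1 mult_1 vabs_eq_0_iff zero_neq_one)

lemma vabs_diff_commute: "vabs (x - y) = vabs (y - x :: 'a :: ultrametric_field)"
  by (metis dist_commute dist_vabs)

lemma vabs_minus [simp]: "vabs (- x) = vabs (x :: 'a :: ultrametric_field)"
  using vabs_diff_commute[of 0 x] by simp

lemma vabs_diff_le_max: "vabs (x - y) \<le> max (vabs x) (vabs (y :: 'a :: ultrametric_field))"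
  using vabs_plus_le_max[of x "- y"] by simp

lemma vabs_power: "vabs (x ^ n) = vabs (x :: 'a :: ultrametric_field) ^ n"
  by (induction n) (simp_all add: vabs_times)

lemma vabs_inverse: "vabs (inverse x) = inverse (vabs (x :: 'a :: ultrametric_field))"
proof (cases "x = 0")
  case False
  then have "vabs (inverse x) * vabs x = 1"
    by (simp flip: vabs_times)
  then show ?thesis
    using False by (simp add: field_simps)
qed simp

lemma vabs_divide: "vabs (x / y) = vabs x / vabs (y :: 'a :: ultrametric_field)"
  by (simp add: divide_inverse vabs_times vabs_inverse)

lemma vabs_add_le: "vabs x \<le> C \<Longrightarrow> vabs y \<le> C \<Longrightarrow> vabs (x + y :: 'a :: ultrametric_field) \<le> C"
  using vabs_plus_le_max[of x y] by linarith

lemma vabs_add_less: "vabs x < C \<Longrightarrow> vabs y < C \<Longrightarrow> vabs (x + y :: 'a :: ultrametric_field) < C"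
  using vabs_plus_le_max[of x y] by linarith

lemma vabs_diff_le: "vabs x \<le> C \<Longrightarrow> vabs y \<le> C \<Longrightarrow> vabs (x - y :: 'a :: ultrametric_field) \<le> C"
  using vabs_diff_le_max[of x y] by linarith

lemma vabs_diff_less: "vabs x < C \<Longrightarrow> vabs y < C \<Longrightarrow> vabs (x - y :: 'a :: ultrametric_field) < C"
  using vabs_diff_le_max[of x y] by linarith

lemma vabs_eq_of_close: "vabs (x - y) < vabs y \<Longrightarrow> vabs x = vabs (y :: 'a :: ultrametric_field)"
  using vabs_plus_le_max[of "x - y" y] vabs_diff_le_max[of x "x - y"] by auto

lemma vabs_sum_le:
  assumes "\<And>i. i \<in> A \<Longrightarrow> vabs (g i :: 'a :: ultrametric_field) \<le> C" "0 \<le> C"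
  shows "vabs (\<Sum>i\<in>A. g i) \<le> C"
  using assms by (induction A rule: infinite_finite_induct) (auto intro: vabs_add_le)

lemma vabs_sum_less:
  assumes "\<And>i. i \<in> A \<Longrightarrow> vabs (g i :: 'a :: ultrametric_field) < C" "0 < C"
  shows "vabs (\<Sum>i\<in>A. g i) < C"
  using assms by (induction A rule: infinite_finite_induct) (auto intro: vabs_add_less)

lemma vabs_of_nat_le: "vabs (of_nat n :: 'a :: ultrametric_field) \<le> 1"
  by (induction n) (auto intro: vabs_add_le)

lemma vabs_mult_le_1: "vabs x \<le> 1 \<Longrightarrow> vabs y \<le> 1 \<Longrightarrow> vabs (x * y :: 'a :: ultrametric_field) \<le> 1"
  by (simp add: vabs_times mult_le_one)

lemma vabs_mult_less_1:
  "vabs x \<le> 1 \<Longrightarrow> vabs y < 1 \<Longrightarrow> vabs (x * y :: 'a :: ultrametric_field) < 1"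
  by (metis mult_left_le_one_le vabs_nonneg vabs_times order_le_less_trans)

section \<open>Convergence\<close>

lemma tendsto_vabs_iff:
  "(g \<longlonglongrightarrow> (l :: 'a :: ultrametric_field)) \<longleftrightarrow> (\<lambda>n. vabs (g n - l)) \<longlonglongrightarrow> 0"
  by (subst tendsto_dist_iff) (simp add: dist_vabs)

lemma tendsto_0_vabs_iff:
  "(g \<longlonglongrightarrow> (0 :: 'a :: ultrametric_field)) \<longleftrightarrow> (\<lambda>n. vabs (g n)) \<longlonglongrightarrow> 0"
  by (simp add: tendsto_vabs_iff)

text \<open>
  With the field operations known to be continuous, the library's calculus of limits and of series
  applies.
\<close>

instance ultrametric_field < topological_ab_group_add
proof
  fix a b :: 'a
  show "((\<lambda>x. fst x + snd x) \<longlongrightarrow> a + b) (nhds a \<times>\<^sub>F nhds b)"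
  proof (rule metric_tendsto_imp_tendsto[where f = "\<lambda>x. max (dist (fst x) a) (dist (snd x) b)" and a = "0::real"])
    have "((\<lambda>x. max (dist (fst x) a) (dist (snd x) b)) \<longlongrightarrow> max (dist a a) (dist b b)) (nhds a \<times>\<^sub>F nhds b)"
      by (intro tendsto_intros filterlim_fst filterlim_snd)
    then show "((\<lambda>x. max (dist (fst x) a) (dist (snd x) b)) \<longlongrightarrow> 0) (nhds a \<times>\<^sub>F nhds b)"
      by simp
    have "dist (fst x + snd x) (a + b) \<le> max (dist (fst x) a) (dist (snd x) b)" for x :: "'a \<times> 'a"
      using vabs_plus_le_max[of "fst x - a" "snd x - b"]
      by (simp add: dist_vabs algebra_simps)
    then show "\<forall>\<^sub>F x in nhds a \<times>\<^sub>F nhds b.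
        dist (fst x + snd x) (a + b) \<le> dist (max (dist (fst x) a) (dist (snd x) b)) 0"
      by (intro always_eventually) (auto simp: dist_real_def intro: order_trans[OF _ abs_ge_self])
  qed
  show "(uminus \<longlongrightarrow> - a) (nhds a)"
  proof (rule metric_tendsto_imp_tendsto[where f = "\<lambda>x. x" and a = a])
    show "\<forall>\<^sub>F x in nhds a. dist (- x) (- a) \<le> dist x a"
      by (intro always_eventually)
        (metis dist_vabs minus_diff_minus order_refl vabs_minus)
  qed (rule filterlim_ident)
qed

instance ultrametric_field < topological_semigroup_mult
proof
  fix a b :: 'a
  show "((\<lambda>x. fst x * snd x) \<longlongrightarrow> a * b) (nhds a \<times>\<^sub>F nhds b)"
  proof (rule metric_tendsto_imp_tendsto[where a = "0::real" and
        f = "\<lambda>x. vabs a * dist (snd x) b + vabs b * dist (fst x) a + dist (fst x) a * dist (snd x) b"])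
    have "((\<lambda>x. vabs a * dist (snd x) b + vabs b * dist (fst x) a + dist (fst x) a * dist (snd x) b)
        \<longlongrightarrow> vabs a * dist b b + vabs b * dist a a + dist a a * dist b b) (nhds a \<times>\<^sub>F nhds b)"
      by (intro tendsto_intros filterlim_fst filterlim_snd)
    then show "((\<lambda>x. vabs a * dist (snd x) b + vabs b * dist (fst x) a + dist (fst x) a * dist (snd x) b)
        \<longlongrightarrow> 0) (nhds a \<times>\<^sub>F nhds b)"
      by simp
    have "dist (fst x * snd x) (a * b)
        \<le> vabs a * dist (snd x) b + vabs b * dist (fst x) a + dist (fst x) a * dist (snd x) b"
      for x :: "'a \<times> 'a"
    proof -
      obtain u v where x: "x = (u, v)" by force
      have "u * v - a * b = a * (v - b) + (b * (u - a) + (u - a) * (v - b))"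
        by (simp add: algebra_simps)
      also have "vabs \<dots> \<le> max (vabs (a * (v - b))) (max (vabs (b * (u - a))) (vabs ((u - a) * (v - b))))"
        using vabs_plus_le_max[of "a * (v - b)" "b * (u - a) + (u - a) * (v - b)"]
          vabs_plus_le_max[of "b * (u - a)" "(u - a) * (v - b)"] by linarith
      also have "\<dots> \<le> vabs (a * (v - b)) + vabs (b * (u - a)) + vabs ((u - a) * (v - b))"
        using vabs_nonneg[of "a * (v - b)"] vabs_nonneg[of "b * (u - a)"]
          vabs_nonneg[of "(u - a) * (v - b)"] by linarith
      finally show ?thesis
        by (simp add: x dist_vabs vabs_times)
    qed
    then show "\<forall>\<^sub>F x in nhds a \<times>\<^sub>F nhds b. dist (fst x * snd x) (a * b)
        \<le> dist (vabs a * dist (snd x) b + vabs b * dist (fst x) a + dist (fst x) a * dist (snd x) b) 0"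
      by (intro always_eventually) (auto simp: dist_real_def intro: order_trans[OF _ abs_ge_self])
  qed
qed

lemma summable_of_tendsto_0:
  fixes t :: "nat \<Rightarrow> 'a :: {ultrametric_field, complete_space}"
  assumes "t \<longlonglongrightarrow> 0"
  shows "summable t"
proof -
  have "Cauchy (\<lambda>n. \<Sum>i<n. t i)"
  proof (rule metric_CauchyI)
    fix e :: real assume e: "e > 0"
    obtain N where N: "vabs (t n) < e" if "n \<ge> N" for n
      using order_tendstoD(2)[OF assms[unfolded tendsto_0_vabs_iff] e]
      by (auto simp: eventually_sequentially)
    have *: "vabs ((\<Sum>i<n. t i) - (\<Sum>i<m. t i)) < e" if "m \<ge> N" "m \<le> n" for m n
    proof -
      have "(\<Sum>i<n. t i) - (\<Sum>i<m. t i) = (\<Sum>i=m..<n. t i)"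
        using that sum_diff_nat_ivl[of 0 m n t] by (simp add: lessThan_atLeast0)
      also have "vabs \<dots> < e"
        using that N e by (intro vabs_sum_less) auto
      finally show ?thesis .
    qed
    have "dist (\<Sum>i<m. t i) (\<Sum>i<n. t i) < e" if "m \<ge> N" "n \<ge> N" for m n
      using *[of m n] *[of n m] that by (cases "m \<le> n") (auto simp: dist_vabs vabs_diff_commute)
    then show "\<exists>N. \<forall>m\<ge>N. \<forall>n\<ge>N. dist (\<Sum>i<m. t i) (\<Sum>i<n. t i) < e" by blast
  qed
  then show ?thesis
    unfolding summable_iff_convergent by (rule Cauchy_convergent)
qed

lemma tendsto_0_of_summable:
  fixes t :: "nat \<Rightarrow> 'a :: ultrametric_field"
  assumes "summable t"
  shows "t \<longlonglongrightarrow> 0"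
proof -
  obtain l where l: "(\<lambda>n. \<Sum>i<n. t i) \<longlonglongrightarrow> l"
    using assms unfolding summable_def sums_def by blast
  have "(\<lambda>n. (\<Sum>i<Suc n. t i) - (\<Sum>i<n. t i)) \<longlonglongrightarrow> l - l"
    using LIMSEQ_Suc[OF l] l by (rule tendsto_diff)
  then show ?thesis by simp
qed

lemma vabs_limit_le:
  fixes l :: "'a :: ultrametric_field"
  assumes "g \<longlonglongrightarrow> l" "\<forall>\<^sub>F n in sequentially. vabs (g n) \<le> C"
  shows "vabs l \<le> C"
proof (rule tendsto_le[OF sequentially_bot tendsto_const _ assms(2)])
  have "(\<lambda>n. dist (g n) 0) \<longlonglongrightarrow> dist l 0"
    by (intro tendsto_intros assms(1))
  then show "(\<lambda>n. vabs (g n)) \<longlonglongrightarrow> vabs l" by (simp add: dist_vabs)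
qed

lemma vabs_suminf_le:
  fixes t :: "nat \<Rightarrow> 'a :: ultrametric_field"
  assumes "summable t" "\<And>n. vabs (t n) \<le> C"
  shows "vabs (suminf t) \<le> C"
proof (rule vabs_limit_le[OF summable_LIMSEQ[OF assms(1)]])
  have "0 \<le> C" using assms(2) vabs_nonneg order_trans by blast
  then show "\<forall>\<^sub>F n in sequentially. vabs (\<Sum>i<n. t i) \<le> C"
    using assms(2) by (intro always_eventually allI vabs_sum_le) auto
qed

text \<open>
  The partial sums of a Cauchy product and the products of partial sums differ by terms
  \<open>a i * b j\<close> with \<open>i + j \<ge> N\<close>, in which one of the two factors is small.
\<close>

lemma cauchy_product_sums_ultrametric:
  fixes a b :: "nat \<Rightarrow> 'a :: {ultrametric_field, complete_space}"
  assumes a: "a \<longlonglongrightarrow> 0" and b: "b \<longlonglongrightarrow> 0"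
  shows "(\<lambda>n. \<Sum>i\<le>n. a i * b (n - i)) sums (suminf a * suminf b)"
proof -
  obtain A where A: "A > 0" "vabs (a n) \<le> A" for n
    using a convergent_imp_Bseq[of "\<lambda>n. vabs (a n)"] unfolding tendsto_0_vabs_iff Bseq_def convergent_def
    by auto
  obtain B where B: "B > 0" "vabs (b n) \<le> B" for n
    using b convergent_imp_Bseq[of "\<lambda>n. vabs (b n)"] unfolding tendsto_0_vabs_iff Bseq_def convergent_def
    by auto
  let ?S = "\<lambda>N. \<Sum>n<N. \<Sum>i\<le>n. a i * b (n - i)"
  let ?P = "\<lambda>N. (\<Sum>i<N. a i) * (\<Sum>j<N. b j)"
  have "(\<lambda>N. ?P N - ?S N) \<longlonglongrightarrow> 0"
  proof (rule metric_LIMSEQ_I)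
    fix e :: real assume e: "e > 0"
    obtain Na where Na: "vabs (a n) < e / B / 2" if "n \<ge> Na" for n
      using order_tendstoD(2)[OF a[unfolded tendsto_0_vabs_iff], of "e / B / 2"] e \<open>B > 0\<close>
      by (auto simp: eventually_sequentially)
    obtain Nb where Nb: "vabs (b n) < e / A / 2" if "n \<ge> Nb" for n
      using order_tendstoD(2)[OF b[unfolded tendsto_0_vabs_iff], of "e / A / 2"] e \<open>A > 0\<close>
      by (auto simp: eventually_sequentially)
    have "vabs (?P N - ?S N) < e" if N: "N \<ge> Na + Nb" for N
    proof -
      let ?Q = "{..<N} \<times> {..<N}" and ?T = "{(i, j). i + j < N}"
      have sub: "?T \<subseteq> ?Q" by auto
      have "?P N = (\<Sum>(i, j)\<in>?Q. a i * b j)"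
        by (simp add: sum_product sum.cartesian_product)
      moreover have "?S N = (\<Sum>(i, j)\<in>?T. a i * b j)"
        by (simp add: sum.triangle_reindex)
      ultimately have "?P N - ?S N = (\<Sum>(i, j)\<in>?Q - ?T. a i * b j)"
        using sum_diff[OF _ sub, of "\<lambda>(i, j). a i * b j"] by simp
      also have "vabs \<dots> < e"
      proof (rule vabs_sum_less)
        fix x assume "x \<in> ?Q - ?T"
        then obtain i j where x: "x = (i, j)" "i + j \<ge> N" by force
        then have "i \<ge> Na \<or> j \<ge> Nb" using N by linarith
        then have "vabs (a i) * vabs (b j) \<le> e / 2"
        proof
          assume "i \<ge> Na"
          then have "vabs (a i) * vabs (b j) \<le> e / B / 2 * B"
            using Na[of i] B(2)[of j] \<open>B > 0\<close> e by (intro mult_mono) auto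
          then show ?thesis using \<open>B > 0\<close> by simp
        next
          assume "j \<ge> Nb"
          then have "vabs (a i) * vabs (b j) \<le> A * (e / A / 2)"
            using Nb[of j] A(2)[of i] \<open>A > 0\<close> e by (intro mult_mono) auto
          then show ?thesis using \<open>A > 0\<close> by simp
        qed
        then show "vabs (case x of (i, j) \<Rightarrow> a i * b j) < e"
          using e by (simp add: x vabs_times)
      qed (rule e)
      finally show ?thesis .
    qed
    then show "\<exists>N0. \<forall>N\<ge>N0. dist (?P N - ?S N) 0 < e"
      by (auto simp: dist_vabs)
  qed
  moreover have "?P \<longlonglongrightarrow> suminf a * suminf b"
    using assms by (intro tendsto_mult summable_LIMSEQ summable_of_tendsto_0)
  ultimately have "(\<lambda>N. ?P N - (?P N - ?S N)) \<longlonglongrightarrow> suminf a * suminf b - 0"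
    by (intro tendsto_diff)
  then show ?thesis by (simp add: sums_def)
qed

section \<open>Power series as functions on disks\<close>

definition integral_fps :: "'a :: ultrametric_field fps \<Rightarrow> bool" where
  "integral_fps g \<longleftrightarrow> (\<forall>n. vabs (fps_nth g n) \<le> 1)"

lemma converges_at_iff:
  fixes g :: "'a :: {ultrametric_field, complete_space} fps"
  shows "converges_at g x \<longleftrightarrow> (\<lambda>n. fps_nth g n * x ^ n) \<longlonglongrightarrow> 0"
  unfolding converges_at_def using summable_of_tendsto_0 tendsto_0_of_summable by blast

lemma power_tendsto_0: "vabs (x :: 'a :: ultrametric_field) < 1 \<Longrightarrow> (\<lambda>n. x ^ n) \<longlonglongrightarrow> 0"
  by (simp add: tendsto_0_vabs_iff vabs_power LIMSEQ_realpow_zero)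

lemma tendsto_0_mult_bounded:
  fixes a b :: "nat \<Rightarrow> 'a :: ultrametric_field"
  assumes "a \<longlonglongrightarrow> 0" "\<And>n. vabs (b n) \<le> 1"
  shows "(\<lambda>n. a n * b n) \<longlonglongrightarrow> 0"
  unfolding tendsto_0_vabs_iff
proof (rule tendsto_sandwich[OF _ _ tendsto_const assms(1)[unfolded tendsto_0_vabs_iff]])
  show "\<forall>\<^sub>F n in sequentially. vabs (a n * b n) \<le> vabs (a n)"
    using assms(2) by (intro always_eventually) (simp add: vabs_times mult_left_le)
qed simp

lemma converges_at_integral:
  fixes g :: "'a :: {ultrametric_field, complete_space} fps"
  assumes "integral_fps g" "vabs x < 1"
  shows "converges_at g x"
  unfolding converges_at_iff
  using tendsto_0_mult_bounded[OF power_tendsto_0[OF assms(2)], of "fps_nth g"] assms(1)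
  by (simp add: integral_fps_def mult.commute)

lemma converges_at_unit_disk:
  fixes g :: "'a :: {ultrametric_field, complete_space} fps"
  assumes "fps_nth g \<longlonglongrightarrow> 0" "vabs x \<le> 1"
  shows "converges_at g x"
  unfolding converges_at_iff
  using assms(2) by (intro tendsto_0_mult_bounded assms(1)) (simp add: vabs_power power_le_one)

lemma vabs_fps_value_le:
  fixes g :: "'a :: {ultrametric_field, complete_space} fps"
  assumes "converges_at g x" "\<And>n. vabs (fps_nth g n) * vabs x ^ n \<le> C"
  shows "vabs (fps_value g x) \<le> C"
  using assms unfolding converges_at_def fps_value_def
  by (intro vabs_suminf_le) (auto simp: vabs_times vabs_power)

lemma fps_value_add:
  fixes g h :: "'a :: {ultrametric_field, complete_space} fps"
  assumes "converges_at g x" "converges_at h x"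
  shows "converges_at (g + h) x" "fps_value (g + h) x = fps_value g x + fps_value h x"
  using summable_add[OF assms[unfolded converges_at_def]] suminf_add[OF assms[unfolded converges_at_def]]
  by (simp_all add: converges_at_def fps_value_def ring_distribs)

lemma fps_value_mult:
  fixes g h :: "'a :: {ultrametric_field, complete_space} fps"
  assumes "converges_at g x" "converges_at h x"
  shows "converges_at (g * h) x" "fps_value (g * h) x = fps_value g x * fps_value h x"
proof -
  have "fps_nth (g * h) n * x ^ n = (\<Sum>i\<le>n. (fps_nth g i * x ^ i) * (fps_nth h (n - i) * x ^ (n - i)))" for n
    unfolding fps_mult_nth sum_distrib_right atLeast0AtMost
    by (intro sum.cong refl) (auto simp: mult_ac simp flip: power_add)
  then have "(\<lambda>n. fps_nth (g * h) n * x ^ n) sums (fps_value g x * fps_value h x)"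
    unfolding fps_value_def
    using cauchy_product_sums_ultrametric[OF assms[unfolded converges_at_iff]] by simp
  then show "converges_at (g * h) x" "fps_value (g * h) x = fps_value g x * fps_value h x"
    unfolding converges_at_def fps_value_def by (auto simp: sums_iff)
qed

lemma fps_value_const [simp]:
  "converges_at (fps_const c) (x :: 'a :: {ultrametric_field, complete_space})"
  "fps_value (fps_const c) x = c"
proof -
  have "(\<lambda>n. fps_nth (fps_const c) n * x ^ n) sums (\<Sum>n\<in>{0}. fps_nth (fps_const c) n * x ^ n)"
    by (rule sums_finite) auto
  then show "converges_at (fps_const c) x" "fps_value (fps_const c) x = c"
    unfolding converges_at_def fps_value_def by (auto simp: sums_iff)
qed

lemma fps_value_X [simp]:
  "converges_at fps_X (x :: 'a :: {ultrametric_field, complete_space})"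
  "fps_value fps_X x = x"
proof -
  have "(\<lambda>n. fps_nth fps_X n * x ^ n) sums (\<Sum>n\<in>{1}. fps_nth fps_X n * x ^ n)"
    by (rule sums_finite) auto
  then show "converges_at fps_X x" "fps_value fps_X x = x"
    unfolding converges_at_def fps_value_def by (auto simp: sums_iff)
qed

lemma fps_value_power:
  fixes g :: "'a :: {ultrametric_field, complete_space} fps"
  assumes "converges_at g x"
  shows "converges_at (g ^ n) x \<and> fps_value (g ^ n) x = fps_value g x ^ n"
proof (induction n)
  case 0
  then show ?case using fps_value_const[of 1 x] by simp
next
  case (Suc n)
  then show ?case using fps_value_mult[OF assms, of "g ^ n"] by simp
qed

lemma integral_fps_1 [simp]: "integral_fps 1"
  by (simp add: integral_fps_def)

lemma integral_fps_const: "vabs c \<le> 1 \<Longrightarrow> integral_fps (fps_const c)"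
  by (simp add: integral_fps_def)

lemma integral_fps_X [simp]: "integral_fps fps_X"
  by (simp add: integral_fps_def fps_X_def)

lemma integral_fps_add: "integral_fps g \<Longrightarrow> integral_fps h \<Longrightarrow> integral_fps (g + h)"
  by (auto simp: integral_fps_def intro: vabs_add_le)

lemma integral_fps_diff: "integral_fps g \<Longrightarrow> integral_fps h \<Longrightarrow> integral_fps (g - h)"
  by (auto simp: integral_fps_def intro: vabs_diff_le)

lemma integral_fps_mult: "integral_fps g \<Longrightarrow> integral_fps h \<Longrightarrow> integral_fps (g * h)"
  by (auto simp: integral_fps_def fps_mult_nth intro!: vabs_sum_le vabs_mult_le_1)

lemma integral_fps_power: "integral_fps g \<Longrightarrow> integral_fps (g ^ n)"
  by (induction n) (auto intro: integral_fps_mult)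

lemma integral_fps_sum:
  "(\<And>i. i \<in> A \<Longrightarrow> integral_fps (g i)) \<Longrightarrow> integral_fps (\<Sum>i\<in>A. g i)"
  by (auto simp: integral_fps_def fps_sum_nth intro!: vabs_sum_le)

lemma integral_fps_compose: "integral_fps g \<Longrightarrow> integral_fps h \<Longrightarrow> integral_fps (g oo h)"
  using integral_fps_power[of h]
  by (auto simp: integral_fps_def fps_compose_nth intro!: vabs_sum_le vabs_mult_le_1)

lemma integral_fps_left_inverse:
  fixes g h :: "'a :: ultrametric_field fps"
  assumes h: "integral_fps h" "fps_nth h 0 = 0" "vabs (fps_nth h 1) = 1" and gh: "g oo h = fps_X"
  shows "integral_fps g"
proof -
  have "vabs (fps_nth g n) \<le> 1" for n
  proof (induction n rule: less_induct)
    case (less n)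
    have "fps_nth fps_X n = (\<Sum>i\<in>insert n {..<n}. fps_nth g i * fps_nth (h ^ i) n)"
      unfolding gh[symmetric] fps_compose_nth by (rule sum.cong) auto
    also have "\<dots> = fps_nth g n * fps_nth h 1 ^ n + (\<Sum>i<n. fps_nth g i * fps_nth (h ^ i) n)"
      using startsby_zero_power_nth_same[OF h(2), of n] by simp
    finally have "fps_nth g n * fps_nth h 1 ^ n = fps_nth fps_X n - (\<Sum>i<n. fps_nth g i * fps_nth (h ^ i) n)"
      by (simp add: algebra_simps)
    also have "vabs \<dots> \<le> 1"
      using less integral_fps_power[OF h(1)] integral_fps_X[where 'a = 'a]
      by (intro vabs_diff_le vabs_sum_le vabs_mult_le_1) (auto simp: integral_fps_def)
    finally show ?case by (simp add: vabs_times vabs_power h(3)[unfolded One_nat_def])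
  qed
  then show ?thesis by (simp add: integral_fps_def)
qed

lemma vabs_fps_value_integral_le:
  fixes h :: "'a :: {ultrametric_field, complete_space} fps"
  assumes "integral_fps h" "fps_nth h 0 = 0" "vabs x < 1"
  shows "vabs (fps_value h x) \<le> vabs x"
proof (rule vabs_fps_value_le[OF converges_at_integral[OF assms(1,3)]])
  fix n
  show "vabs (fps_nth h n) * vabs x ^ n \<le> vabs x"
  proof (cases n)
    case (Suc m)
    have "vabs (fps_nth h n) * vabs x ^ n \<le> 1 * vabs x ^ 1"
      using assms Suc by (intro mult_mono power_decreasing) (auto simp: integral_fps_def)
    then show ?thesis by simp
  qed (simp add: assms(2))
qed

text \<open>
  Cutting the outer series off at degree \<open>N\<close> changes neither side by more than \<open>\<bar>x\<bar>\<^sup>N\<close>, because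
  \<open>h ^ k\<close> starts in degree \<open>k\<close>; for the finitely many remaining terms the claim is the
  multiplicativity of evaluation.
\<close>

lemma fps_value_compose:
  fixes g h :: "'a :: {ultrametric_field, complete_space} fps"
  assumes g: "integral_fps g" and h: "integral_fps h" "fps_nth h 0 = 0" and x: "vabs x < 1"
  shows "fps_value (g oo h) x = fps_value g (fps_value h x)"
proof -
  let ?y = "fps_value h x"
  let ?S = "\<lambda>N. \<Sum>n<N. fps_nth (g oo h) n * x ^ n"
  let ?T = "\<lambda>N. \<Sum>k<N. fps_nth g k * ?y ^ k"
  have y: "vabs ?y < 1"
    using vabs_fps_value_integral_le[OF h x] x by linarith
  have tail: "vabs (?y ^ k - (\<Sum>n<N. fps_nth (h ^ k) n * x ^ n)) \<le> vabs x ^ N" for k N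
  proof -
    have pk: "converges_at (h ^ k) x" "fps_value (h ^ k) x = ?y ^ k"
      using fps_value_power[OF converges_at_integral[OF h(1) x], of k] by auto
    have sm: "summable (\<lambda>n. fps_nth (h ^ k) n * x ^ n)"
      using pk(1) by (simp add: converges_at_def)
    have "vabs ((\<Sum>n<M. fps_nth (h ^ k) n * x ^ n) - (\<Sum>n<N. fps_nth (h ^ k) n * x ^ n)) \<le> vabs x ^ N"
      if "M \<ge> N" for M
    proof -
      have "(\<Sum>n<M. fps_nth (h ^ k) n * x ^ n) - (\<Sum>n<N. fps_nth (h ^ k) n * x ^ n)
          = (\<Sum>n=N..<M. fps_nth (h ^ k) n * x ^ n)"
        using that sum_diff_nat_ivl[of 0 N M] by (simp add: lessThan_atLeast0)
      also have "vabs \<dots> \<le> vabs x ^ N"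
      proof (rule vabs_sum_le)
        fix n assume "n \<in> {N..<M}"
        then have "vabs (fps_nth (h ^ k) n) * vabs x ^ n \<le> 1 * vabs x ^ N"
          using x integral_fps_power[OF h(1), of k]
          by (intro mult_mono power_decreasing) (auto simp: integral_fps_def)
        then show "vabs (fps_nth (h ^ k) n * x ^ n) \<le> vabs x ^ N"
          by (simp add: vabs_times vabs_power)
      qed simp
      finally show ?thesis .
    qed
    then have "\<forall>\<^sub>F M in sequentially.
        vabs ((\<Sum>n<M. fps_nth (h ^ k) n * x ^ n) - (\<Sum>n<N. fps_nth (h ^ k) n * x ^ n)) \<le> vabs x ^ N"
      by (auto simp: eventually_sequentially)
    then show ?thesis
      using vabs_limit_le[OF tendsto_diff[OF summable_LIMSEQ[OF sm] tendsto_const]]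
      by (simp add: fps_value_def flip: pk(2)[unfolded fps_value_def])
  qed
  have diff: "vabs (?T N - ?S N) \<le> vabs x ^ N" for N
  proof -
    have "fps_nth (g oo h) n = (\<Sum>k<N. fps_nth g k * fps_nth (h ^ k) n)" if "n < N" for n
      unfolding fps_compose_nth
      by (rule sum.mono_neutral_left) (use that startsby_zero_power_prefix[OF h(2)] in auto)
    then have "?S N = (\<Sum>n<N. \<Sum>k<N. fps_nth g k * (fps_nth (h ^ k) n * x ^ n))"
      by (intro sum.cong) (auto simp: sum_distrib_right mult.assoc)
    also have "\<dots> = (\<Sum>k<N. fps_nth g k * (\<Sum>n<N. fps_nth (h ^ k) n * x ^ n))"
      by (subst sum.swap) (simp add: sum_distrib_left)
    finally have "?T N - ?S N = (\<Sum>k<N. fps_nth g k * (?y ^ k - (\<Sum>n<N. fps_nth (h ^ k) n * x ^ n)))"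
      by (simp add: right_diff_distrib sum_subtractf)
    also have "vabs \<dots> \<le> vabs x ^ N"
    proof (rule vabs_sum_le)
      fix k
      show "vabs (fps_nth g k * (?y ^ k - (\<Sum>n<N. fps_nth (h ^ k) n * x ^ n))) \<le> vabs x ^ N"
        using mult_mono[OF _ tail, of "vabs (fps_nth g k)" 1 k N] g
        by (simp add: vabs_times integral_fps_def)
    qed simp
    finally show ?thesis .
  qed
  have "(\<lambda>N. ?T N - ?S N) \<longlonglongrightarrow> 0"
    unfolding tendsto_0_vabs_iff
  proof (rule tendsto_sandwich[OF _ _ tendsto_const])
    show "(\<lambda>N. vabs x ^ N) \<longlonglongrightarrow> 0" using x by (simp add: LIMSEQ_realpow_zero)
  qed (use diff in auto)
  moreover have "?T \<longlonglongrightarrow> fps_value g ?y"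
    unfolding fps_value_def[of g] using converges_at_integral[OF g y]
    by (intro summable_LIMSEQ) (simp add: converges_at_def)
  ultimately have "(\<lambda>N. ?T N - (?T N - ?S N)) \<longlonglongrightarrow> fps_value g ?y - 0"
    by (intro tendsto_diff)
  then have "(\<lambda>n. fps_nth (g oo h) n * x ^ n) sums fps_value g ?y"
    by (simp add: sums_def)
  then show ?thesis
    by (simp add: fps_value_def sums_iff)
qed

text \<open>The conjugate of \<open>g\<close> by the homothety with factor \<open>c\<close>.\<close>

definition rescale :: "'a :: field \<Rightarrow> 'a fps \<Rightarrow> 'a fps" where
  "rescale c g = Abs_fps (\<lambda>n. fps_nth g n * c ^ n / c)"

lemma rescale_nth [simp]: "fps_nth (rescale c g) n = fps_nth g n * c ^ n / c"
  by (simp add: rescale_def)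

lemma rescale_X: "c \<noteq> 0 \<Longrightarrow> rescale c fps_X = fps_X"
  by (rule fps_ext) (auto simp: fps_X_def)

lemma rescale_mult_const: "rescale c (fps_const a * g) = fps_const a * rescale c g"
  by (rule fps_ext) auto

lemma rescale_eq_compose: "rescale c g = fps_const (inverse c) * (g oo (fps_const c * fps_X))"
proof (rule fps_ext)
  fix n
  show "fps_nth (rescale c g) n = fps_nth (fps_const (inverse c) * (g oo (fps_const c * fps_X))) n"
    unfolding fps_mult_left_const_nth fps_nth_compose_linear by (simp add: field_simps)
qed

lemma rescale_compose:
  fixes g h :: "'a :: field fps"
  assumes "c \<noteq> 0" "fps_nth h 0 = 0"
  shows "rescale c (g oo h) = rescale c g oo rescale c h"
proof -
  let ?L = "fps_const c * fps_X"
  have *: "?L oo rescale c h = h oo ?L"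
    using assms by (simp add: fps_compose_mult_distrib rescale_eq_compose flip: mult.assoc)
  have "rescale c g oo rescale c h = fps_const (inverse c) * ((g oo ?L) oo rescale c h)"
    using assms by (simp add: rescale_eq_compose[of c g] fps_compose_mult_distrib)
  also have "(g oo ?L) oo rescale c h = g oo (?L oo rescale c h)"
    using assms by (intro fps_compose_assoc[symmetric]) auto
  also have "\<dots> = (g oo h) oo ?L"
    unfolding * using assms by (intro fps_compose_assoc) auto
  finally show ?thesis
    by (simp add: rescale_eq_compose)
qed

lemma fps_value_rescale:
  fixes g :: "'a :: {ultrametric_field, complete_space} fps"
  assumes "c \<noteq> 0"
  shows "converges_at (rescale c g) x \<longleftrightarrow> converges_at g (c * x)"
    and "converges_at g (c * x) \<Longrightarrow> fps_value (rescale c g) x = fps_value g (c * x) / c"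
proof -
  have t: "fps_nth (rescale c g) n * x ^ n = inverse c * (fps_nth g n * (c * x) ^ n)" for n
    by (simp add: power_mult_distrib field_simps)
  have "(\<lambda>n. inverse c * (fps_nth g n * (c * x) ^ n)) \<longlonglongrightarrow> 0
      \<longleftrightarrow> (\<lambda>n. fps_nth g n * (c * x) ^ n) \<longlonglongrightarrow> 0"
    using tendsto_mult[OF tendsto_const, of "\<lambda>n. fps_nth g n * (c * x) ^ n" 0 sequentially "inverse c"]
      tendsto_mult[OF tendsto_const, of "\<lambda>n. inverse c * (fps_nth g n * (c * x) ^ n)" 0 sequentially c]
      assms by (auto simp flip: mult.assoc)
  then show "converges_at (rescale c g) x \<longleftrightarrow> converges_at g (c * x)"
    unfolding converges_at_iff t .
  assume "converges_at g (c * x)"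
  then have "(\<lambda>N. \<Sum>n<N. fps_nth g n * (c * x) ^ n) \<longlonglongrightarrow> fps_value g (c * x)"
    unfolding converges_at_def fps_value_def by (rule summable_LIMSEQ)
  then have "(\<lambda>N. inverse c * (\<Sum>n<N. fps_nth g n * (c * x) ^ n)) \<longlonglongrightarrow> inverse c * fps_value g (c * x)"
    by (intro tendsto_mult tendsto_const)
  then have "(\<lambda>n. fps_nth (rescale c g) n * x ^ n) sums (inverse c * fps_value g (c * x))"
    unfolding sums_def t by (simp add: sum_distrib_left)
  then show "fps_value (rescale c g) x = fps_value g (c * x) / c"
    unfolding fps_value_def[of "rescale c g"] by (simp add: sums_iff field_simps)
qed

section \<open>Powers of the multiplier\<close>

lemma vabs_of_nat_coprime:
  assumes "prime p" "vabs (of_nat p :: 'a :: ultrametric_field) = 1 / real p" "\<not> p dvd n"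
  shows "vabs (of_nat n :: 'a) = 1"
proof -
  have "coprime n p"
    using assms(1,3) by (metis coprime_commute prime_imp_coprime)
  moreover have "n \<noteq> 0" using assms(3) by (intro notI) simp
  ultimately obtain x y where xy: "n * x = p * y + 1"
    using bezout_nat[of n p] by auto
  have "vabs (of_nat p * of_nat y :: 'a) < 1"
    using vabs_mult_less_1[of "of_nat y :: 'a" "of_nat p"] vabs_of_nat_le[of y, where 'a = 'a]
      assms(2) prime_gt_1_nat[OF assms(1)] by (simp add: mult.commute)
  then have "vabs (of_nat p * of_nat y + 1 :: 'a) = 1"
    using vabs_eq_of_close[of "of_nat p * of_nat y + 1 :: 'a" 1] by simp
  then have "vabs (of_nat n :: 'a) * vabs (of_nat x :: 'a) = 1"
    using arg_cong[OF xy, of "\<lambda>k. vabs (of_nat k :: 'a)"] by (simp add: vabs_times add.commute)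
  then show ?thesis
    using mult_left_le[of "vabs (of_nat x :: 'a)" "vabs (of_nat n :: 'a)"]
      vabs_of_nat_le[of x, where 'a = 'a] vabs_of_nat_le[of n, where 'a = 'a] by auto
qed

lemma vabs_of_nat_dvd_le:
  assumes "vabs (of_nat p :: 'a :: ultrametric_field) = 1 / real p" "p dvd n"
  shows "vabs (of_nat n :: 'a) \<le> 1 / real p"
proof -
  obtain k where "n = p * k" using assms(2) by blast
  then have "vabs (of_nat n :: 'a) = 1 / real p * vabs (of_nat k :: 'a)"
    using assms(1) by (simp add: vabs_times)
  also have "\<dots> \<le> 1 / real p * 1"
    using vabs_of_nat_le[of k, where 'a = 'a] by (intro mult_left_mono) auto
  finally show ?thesis by simp
qed

text \<open>
  Only the multiples of \<open>p\<close> matter. With \<open>m = n div p\<close> their product is \<open>p ^ m\<close> times the factorial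
  of \<open>m\<close>, so by induction the exponent of \<open>p\<close> is at most \<open>m + m \<le> n\<close>.
\<close>

lemma prod_vabs_of_nat_ge:
  assumes p: "prime p" "vabs (of_nat p :: 'a :: ultrametric_field) = 1 / real p"
  shows "(1 / real p) ^ n \<le> (\<Prod>i=1..n. vabs (of_nat i :: 'a))"
proof (induction n rule: less_induct)
  case (less n)
  have p1: "p > 1" using prime_gt_1_nat[OF p(1)] .
  show ?case
  proof (cases "n = 0")
    case False
    define m where "m = n div p"
    have m: "m < n" "2 * m \<le> n"
      using False p1 div_less_dividend[of p n] order_trans[OF mult_le_mono1[of 2 p m]]
        times_div_less_eq_dividend[of p n] unfolding m_def by auto
    let ?M = "{i \<in> {1..n}. p dvd i}"
    have M: "?M = (*) p ` {1..m}"
    proof (intro equalityI subsetI)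
      fix i assume "i \<in> ?M"
      then obtain j where j: "i = p * j" "1 \<le> i" "i \<le> n" by auto
      then have "j \<le> m" using p1 by (simp add: m_def less_eq_div_iff_mult_less_eq mult.commute)
      moreover have "1 \<le> j" using j by (cases j) auto
      ultimately show "i \<in> (*) p ` {1..m}" using j(1) by auto
    next
      fix i assume "i \<in> (*) p ` {1..m}"
      then obtain j where "i = p * j" "j \<in> {1..m}" by blast
      then show "i \<in> ?M"
        using p1 by (auto simp: m_def less_eq_div_iff_mult_less_eq mult.commute)
    qed
    have "(\<Prod>i=1..n. vabs (of_nat i :: 'a)) = (\<Prod>i\<in>?M. vabs (of_nat i :: 'a))"
      using vabs_of_nat_coprime[OF p] by (intro prod.mono_neutral_right) auto
    also have "\<dots> = (\<Prod>j=1..m. vabs (of_nat (p * j) :: 'a))"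
      unfolding M using p1 by (subst prod.reindex) (auto simp: inj_on_def)
    also have "\<dots> = (1 / real p) ^ m * (\<Prod>j=1..m. vabs (of_nat j :: 'a))"
      unfolding of_nat_mult vabs_times p(2) prod.distrib by simp
    finally have eq: "(\<Prod>i=1..n. vabs (of_nat i :: 'a)) = (1 / real p) ^ m * (\<Prod>j=1..m. vabs (of_nat j :: 'a))" .
    have "(1 / real p) ^ n \<le> (1 / real p) ^ (m + m)"
      using m p1 by (intro power_decreasing) auto
    also have "\<dots> \<le> (1 / real p) ^ m * (\<Prod>j=1..m. vabs (of_nat j :: 'a))"
      unfolding power_add using less[OF m(1)] by (intro mult_left_mono) auto
    finally show ?thesis unfolding eq .
  qed simp
qed

lemma vabs_power_minus_1_le:
  fixes x :: "'a :: ultrametric_field"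
  assumes "vabs x \<le> 1"
  shows "vabs (x ^ n - 1) \<le> vabs (x - 1)"
proof -
  have "vabs (\<Sum>i<n. x ^ i) \<le> 1"
    using assms by (intro vabs_sum_le) (auto simp: vabs_power power_le_one)
  then have "vabs (x - 1) * vabs (\<Sum>i<n. x ^ i) \<le> vabs (x - 1) * 1"
    by (intro mult_left_mono) auto
  then show ?thesis
    by (simp add: power_diff_1_eq vabs_times)
qed

lemma vabs_eq_1_of_close_1: "vabs (x - 1) < 1 \<Longrightarrow> vabs (x :: 'a :: ultrametric_field) = 1"
  using vabs_eq_of_close[of x 1] by simp

lemma vabs_power_minus_1_coprime:
  fixes x :: "'a :: ultrametric_field"
  assumes p: "prime p" "vabs (of_nat p :: 'a) = 1 / real p"
    and x: "vabs (x - 1) < 1" and n: "\<not> p dvd n"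
  shows "vabs (x ^ n - 1) = vabs (x - 1)"
proof -
  have n1: "vabs (of_nat n :: 'a) = 1" by (rule vabs_of_nat_coprime[OF p n])
  have "(\<Sum>i<n. x ^ i) - of_nat n = (\<Sum>i<n. x ^ i - 1)"
    by (simp add: sum_subtractf)
  also have "vabs \<dots> < 1"
    using x vabs_power_minus_1_le[of x] vabs_eq_1_of_close_1[OF x]
    by (intro vabs_sum_less) (auto intro: le_less_trans)
  finally have "vabs (\<Sum>i<n. x ^ i) = 1"
    using vabs_eq_of_close[of "\<Sum>i<n. x ^ i" "of_nat n"] n1 by simp
  then show ?thesis by (simp add: power_diff_1_eq vabs_times)
qed

text \<open>
  Up to terms of order \<open>(x - 1)\<^sup>2\<close>, the sum of \<open>x ^ j\<close> over \<open>j < p\<close> is \<open>p\<close> plus \<open>x - 1\<close> times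
  \<open>p * (p - 1) div 2\<close>; for odd \<open>p\<close> the latter integer is divisible by \<open>p\<close>.
\<close>

lemma vabs_geometric_sum_minus_p_le:
  fixes x :: "'a :: ultrametric_field"
  assumes p: "prime p" "p \<ge> 3" "vabs (of_nat p :: 'a) = 1 / real p" and x: "vabs (x - 1) < 1"
  shows "vabs ((\<Sum>j<p. x ^ j) - of_nat p) \<le> max (vabs (x - 1) / real p) (vabs (x - 1) ^ 2)"
proof -
  define u where "u = x - 1"
  have x1: "vabs x = 1" by (rule vabs_eq_1_of_close_1[OF x])
  have lin: "vabs (x ^ j - 1 - of_nat j * u) \<le> vabs u ^ 2" for j
  proof -
    have "x ^ j - 1 - of_nat j * u = u * (\<Sum>i<j. x ^ i - 1)"
      unfolding power_diff_1_eq[of x j] u_def sum_subtractf by (simp add: algebra_simps)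
    also have "vabs \<dots> \<le> vabs u * vabs u"
      unfolding vabs_times u_def
      using vabs_power_minus_1_le[of x] x1 by (intro mult_left_mono vabs_sum_le) auto
    finally show ?thesis by (simp add: power2_eq_square)
  qed
  have "odd p" using p(1,2) prime_odd_nat[of p] by auto
  then obtain k where k: "p = Suc (2 * k)" by (metis oddE Suc_eq_plus1)
  have "(\<Sum>j<Suc (2 * k). j) = Suc (2 * k) * k"
    by (induction k) auto
  then have "p dvd (\<Sum>j<p. j)"
    unfolding k by (metis dvd_triv_left)
  then have N: "vabs (of_nat (\<Sum>j<p. j) :: 'a) \<le> 1 / real p"
    by (rule vabs_of_nat_dvd_le[OF p(3)])
  have "(\<Sum>j<p. x ^ j) - of_nat p = u * of_nat (\<Sum>j<p. j) + (\<Sum>j<p. x ^ j - 1 - of_nat j * u)"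
    by (simp add: sum_subtractf sum_distrib_left mult.commute)
  also have "vabs \<dots> \<le> max (vabs (u * of_nat (\<Sum>j<p. j))) (vabs (\<Sum>j<p. x ^ j - 1 - of_nat j * u))"
    by (rule vabs_plus_le_max)
  also have "\<dots> \<le> max (vabs u * (1 / real p)) (vabs u ^ 2)"
    unfolding vabs_times using N lin
    by (intro max.mono mult_left_mono vabs_sum_le) auto
  finally show ?thesis by (simp add: u_def)
qed

lemma vabs_power_p_minus_1_le:
  fixes x :: "'a :: ultrametric_field"
  assumes p: "prime p" "p \<ge> 3" "vabs (of_nat p :: 'a) = 1 / real p" and x: "vabs (x - 1) < 1"
  shows "vabs (x ^ p - 1) \<le> vabs (x - 1) * max (1 / real p) (vabs (x - 1) ^ 2)"
proof -
  have "vabs (\<Sum>j<p. x ^ j) \<le> max (vabs ((\<Sum>j<p. x ^ j) - of_nat p)) (1 / real p)"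
    using vabs_plus_le_max[of "(\<Sum>j<p. x ^ j) - of_nat p" "of_nat p"] p(3) by simp
  also have "\<dots> \<le> max (1 / real p) (vabs (x - 1) ^ 2)"
  proof -
    have "vabs (x - 1) / real p \<le> 1 / real p"
      using x by (simp add: divide_right_mono)
    then show ?thesis using vabs_geometric_sum_minus_p_le[OF p x] by linarith
  qed
  finally have "vabs (x - 1) * vabs (\<Sum>j<p. x ^ j) \<le> vabs (x - 1) * max (1 / real p) (vabs (x - 1) ^ 2)"
    by (intro mult_left_mono) auto
  then show ?thesis by (simp add: power_diff_1_eq vabs_times)
qed

text \<open>
  For \<open>n = p\<close> the quotient of \<open>x ^ p - 1\<close> by \<open>x - 1\<close> is so close to \<open>p\<close> that it has the same
  absolute value; an exponent prime to \<open>p\<close> does not change the distance to \<open>1\<close> at all.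
\<close>

lemma vabs_power_minus_1_near_1:
  fixes x :: "'a :: ultrametric_field"
  assumes p: "prime p" "p \<ge> 3" "vabs (of_nat p :: 'a) = 1 / real p" and x: "vabs (x - 1) \<le> 1 / real p"
  shows "vabs (x ^ n - 1) = vabs (of_nat n :: 'a) * vabs (x - 1)"
  using x
proof (induction n arbitrary: x rule: less_induct)
  case (less n)
  have p1: "1 / real p < 1" using p(2) by simp
  have x1: "vabs (x - 1) < 1" using less.prems p1 by linarith
  consider "n = 0" | "n > 0" "p dvd n" | "\<not> p dvd n" by auto
  then show ?case
  proof cases
    case 2
    then obtain m where m: "n = p * m" "m > 0" by auto
    have "vabs (x - 1) / real p < 1 / real p"
      using x1 p(2) by (intro divide_strict_right_mono) auto
    moreover have "vabs (x - 1) ^ 2 < 1 / real p"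
    proof -
      have "vabs (x - 1) ^ 2 \<le> (1 / real p) ^ 2" using less.prems by (intro power_mono) auto
      also have "\<dots> < 1 / real p * 1"
        unfolding power2_eq_square using p(2) p1 by (intro mult_strict_left_mono) auto
      also have "\<dots> = 1 / real p" by simp
      finally show ?thesis .
    qed
    ultimately have "vabs ((\<Sum>j<p. x ^ j) - of_nat p) < vabs (of_nat p :: 'a)"
      using vabs_geometric_sum_minus_p_le[OF p x1] p(3) by simp
    then have "vabs (\<Sum>j<p. x ^ j) = 1 / real p"
      using vabs_eq_of_close p(3) by metis
    then have xp: "vabs (x ^ p - 1) = vabs (x - 1) / real p"
      by (simp add: power_diff_1_eq vabs_times)
    have "vabs ((x ^ p) ^ m - 1) = vabs (of_nat m :: 'a) * vabs (x ^ p - 1)"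
    proof (rule less.IH)
      show "m < n" using m p(2) by simp
      show "vabs (x ^ p - 1) \<le> 1 / real p"
        unfolding xp using x1 p(2) by (intro divide_right_mono) auto
    qed
    then show ?thesis
      by (simp add: m(1) power_mult xp vabs_times p(3))
  next
    case 3
    then show ?thesis
      using vabs_power_minus_1_coprime[OF p(1,3) x1] vabs_of_nat_coprime[OF p(1,3)] by simp
  qed simp
qed

text \<open>
  Some power \<open>x ^ q\<close> with \<open>q\<close> a power of \<open>p\<close> is so close to \<open>1\<close> that the exact formula for
  \<open>x ^ (q * n) - 1\<close> applies, and \<open>x ^ n - 1\<close> divides that number.
\<close>

lemma vabs_power_minus_1_ge:
  fixes x :: "'a :: ultrametric_field"
  assumes p: "prime p" "p \<ge> 3" "vabs (of_nat p :: 'a) = 1 / real p" and x: "vabs (x - 1) < 1"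
    and not_root: "\<And>n. n \<ge> 1 \<Longrightarrow> x ^ n \<noteq> 1"
  obtains c where "c > 0" "\<And>n. c * vabs (of_nat n :: 'a) \<le> vabs (x ^ n - 1)"
proof -
  define r where "r = max (1 / real p) (vabs (x - 1))"
  have r: "0 < r" "r < 1" using x p(2) by (auto simp: r_def less_max_iff_disj)
  have "vabs (x ^ (p ^ a) - 1) \<le> r ^ Suc a" for a
  proof (induction a)
    case (Suc a)
    let ?y = "x ^ (p ^ a)"
    have y: "vabs (?y - 1) < 1" "vabs (?y - 1) \<le> r"
      using vabs_power_minus_1_le[of x "p ^ a"] vabs_eq_1_of_close_1[OF x] x by (auto simp: r_def)
    have "vabs (?y - 1) ^ 2 \<le> vabs (?y - 1)"
      using y(1) by (simp add: power2_eq_square mult_left_le)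
    then have "max (1 / real p) (vabs (?y - 1) ^ 2) \<le> r"
      using y(2) by (auto simp: r_def)
    then have "vabs (?y ^ p - 1) \<le> vabs (?y - 1) * r"
      using vabs_power_p_minus_1_le[OF p y(1)]
      by (meson mult_left_mono order_trans vabs_nonneg)
    also have "\<dots> \<le> r ^ Suc a * r"
      using Suc r by (intro mult_right_mono) auto
    finally show ?case by (simp add: mult.commute flip: power_mult)
  qed (simp add: r_def)
  moreover obtain a where "r ^ a < 1 / real p"
    using real_arch_pow_inv[of "1 / real p" r] r p(2) by auto
  moreover have "r ^ Suc a \<le> r ^ a" using r by (intro power_decreasing) auto
  ultimately have near: "vabs (x ^ (p ^ a) - 1) \<le> 1 / real p"
    by (meson less_eq_real_def order_trans)
  show ?thesis
  proof
    show "vabs (x ^ (p ^ a) - 1) > 0"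
      using not_root[of "p ^ a"] p(2) by simp
    fix n
    have "vabs ((x ^ n) ^ (p ^ a) - 1) \<le> vabs (x ^ n - 1)"
      using vabs_power_minus_1_le[of "x ^ n"] vabs_eq_1_of_close_1[OF x] by (simp add: vabs_power)
    moreover have "(x ^ n) ^ (p ^ a) = (x ^ (p ^ a)) ^ n"
      by (simp add: mult.commute flip: power_mult)
    ultimately show "vabs (x ^ (p ^ a) - 1) * vabs (of_nat n :: 'a) \<le> vabs (x ^ n - 1)"
      using vabs_power_minus_1_near_1[OF p near, of n] by (simp add: mult.commute)
  qed
qed

section \<open>The linearization near the fixed point\<close>

lemma linearization_recurrence:
  assumes H: "is_linearization f H" and f0: "fps_nth f 0 = 0"
  shows "(fps_nth f 1 - fps_nth f 1 ^ n) * fps_nth H n = (\<Sum>i<n. fps_nth H i * fps_nth (f ^ i) n)"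
  using H is_linearization_coeff[OF f0, of H n] unfolding is_linearization_def by metis

lemma vabs_linearization_denominator:
  fixes x :: "'a :: ultrametric_field"
  assumes "vabs (x - 1) < 1"
  shows "vabs (x - x ^ Suc n) = vabs (x ^ n - 1)"
proof -
  have "x - x ^ Suc n = x * (1 - x ^ n)" by (simp add: algebra_simps)
  then show ?thesis
    using vabs_eq_1_of_close_1[OF assms] by (simp add: vabs_times vabs_diff_commute)
qed

text \<open>
  By the recurrence, the coefficients are bounded by the product of the numbers
  \<open>1 / \<bar>1 - \<lambda>\<^sup>i\<bar>\<close>, each of which is at most a constant times \<open>1 / \<bar>i\<bar>\<close>; and the product
  of the \<open>\<bar>i\<bar>\<close> decays at most exponentially.
\<close>

lemma linearization_coeff_exponential_bound:
  fixes f :: "'a :: ultrametric_field fps"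
  assumes p: "prime p" "p \<ge> 3" "vabs (of_nat p :: 'a) = 1 / real p"
    and f: "fps_nth f 0 = 0" "integral_fps f"
    and lam: "vabs (fps_nth f 1 - 1) < 1" "\<And>n. n \<ge> 1 \<Longrightarrow> fps_nth f 1 ^ n \<noteq> 1"
    and H: "is_linearization f H"
  obtains A where "A \<ge> 1" "\<And>n. vabs (fps_nth H (Suc n)) \<le> A ^ n"
proof -
  let ?l = "fps_nth f 1"
  obtain c where c: "c > 0" "\<And>n. c * vabs (of_nat n :: 'a) \<le> vabs (?l ^ n - 1)"
    using vabs_power_minus_1_ge[OF p lam] by blast
  define D where "D n = (\<Prod>i=1..n. 1 / (c * vabs (of_nat i :: 'a)))" for n
  have le1: "c * vabs (of_nat n :: 'a) \<le> 1" for n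
    using c(2)[of n] vabs_power_minus_1_le[of ?l n] vabs_eq_1_of_close_1[OF lam(1)] lam(1) by linarith
  have pos: "c * vabs (of_nat n :: 'a) > 0" if "n \<ge> 1" for n
    using c(1) that by simp
  have Dpos: "D n \<ge> 0" for n
    unfolding D_def using c(1) by (intro prod_nonneg) auto
  have D_Suc: "D (Suc n) = D n / (c * vabs (of_nat (Suc n) :: 'a))" for n
    by (simp add: D_def)
  have "D n \<le> D (Suc n)" for n
    using le1[of "Suc n"] pos[of "Suc n"] Dpos[of n] unfolding D_Suc
    by (simp add: le_divide_eq mult_left_le del: of_nat_Suc)
  then have mono: "D m \<le> D n" if "m \<le> n" for m n
    using that by (rule lift_Suc_mono_le)
  have bound: "vabs (fps_nth H (Suc n)) \<le> D n" for n
  proof (induction n rule: less_induct)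
    case (less n)
    show ?case
    proof (cases n)
      case 0
      then show ?thesis using H by (simp add: D_def is_linearization_def)
    next
      case (Suc m)
      have "vabs (\<Sum>i<Suc n. fps_nth H i * fps_nth (f ^ i) (Suc n)) \<le> D m"
      proof (rule vabs_sum_le[OF _ Dpos])
        fix i assume i: "i \<in> {..<Suc n}"
        show "vabs (fps_nth H i * fps_nth (f ^ i) (Suc n)) \<le> D m"
        proof (cases i)
          case 0
          then show ?thesis using Dpos[of m] by simp
        next
          case (Suc j)
          have "vabs (fps_nth H i) * vabs (fps_nth (f ^ i) (Suc n)) \<le> D j * 1"
            using less[of j] i Suc integral_fps_power[OF f(2), of i]
            by (intro mult_mono) (auto simp: integral_fps_def Dpos)
          also have "\<dots> \<le> D m" using mono[of j m] i Suc \<open>n = Suc m\<close> by simp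
          finally show ?thesis by (simp add: vabs_times)
        qed
      qed
      then have "vabs (?l ^ n - 1) * vabs (fps_nth H (Suc n)) \<le> D m"
        unfolding linearization_recurrence[OF H f(1), symmetric] vabs_times
          vabs_linearization_denominator[OF lam(1)] .
      then have "(c * vabs (of_nat n :: 'a)) * vabs (fps_nth H (Suc n)) \<le> D m"
        using mult_right_mono[OF c(2), of "vabs (fps_nth H (Suc n))" n] by simp
      then show ?thesis
        using pos[of n] D_Suc[of m] Suc by (simp add: le_divide_eq mult.commute)
    qed
  qed
  have "D n \<le> (real p / c) ^ n" for n
  proof -
    have "D n = (1 / c) ^ n * inverse (\<Prod>i=1..n. vabs (of_nat i :: 'a))"
      using prod_inversef[of "\<lambda>i. vabs (of_nat i :: 'a)" "{1..n}"]
      by (simp add: D_def divide_inverse prod.distrib power_inverse comp_def)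
    also have "\<dots> \<le> (1 / c) ^ n * inverse ((1 / real p) ^ n)"
      using prod_vabs_of_nat_ge[OF p(1,3), of n] c(1) p(2)
      by (intro mult_left_mono le_imp_inverse_le) auto
    also have "\<dots> = (real p / c) ^ n" by (simp add: power_divide field_simps)
    finally show ?thesis .
  qed
  moreover have "real p / c \<ge> 1"
  proof -
    have "c \<le> 1" using le1[of 1] by simp
    then show ?thesis using c(1) p(2) by (simp add: le_divide_eq)
  qed
  ultimately show ?thesis
    using bound that[of "real p / c"] order_trans by blast
qed

text \<open>
  After the homothety with factor \<open>c\<close> the map, its linearization and the inverse of the latter all
  have integral coefficients, so the formal identities between them may be evaluated on the open
  unit disk.
\<close>

lemma conjugate_to_linear_on_ball:
  fixes f :: "'a :: {ultrametric_field, complete_space} fps" and c :: 'a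
  assumes f: "fps_nth f 0 = 0" "integral_fps f"
    and H: "is_linearization f (linearization f)"
    and c: "c \<noteq> 0" "vabs c \<le> 1"
    and bound: "\<And>n. vabs (fps_nth (linearization f) (Suc n)) * vabs c ^ n \<le> 1"
  shows "conjugate_to_linear_on f (ball 0 (vabs c))"
proof -
  let ?H = "linearization f"
  define h g F where "h = rescale c ?H" and "g = rescale c (fps_inv ?H)" and "F = rescale c f"
  have H01: "fps_nth ?H 0 = 0" "fps_nth ?H 1 = 1" and Hf: "?H oo f = fps_const (fps_nth f 1) * ?H"
    using H by (auto simp: is_linearization_def)
  have h: "integral_fps h" "fps_nth h 0 = 0" "fps_nth h 1 = 1"
  proof -
    have "vabs (fps_nth h n) \<le> 1" for n
      using bound[of "n - 1"] H01(1) c(1)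
      by (cases n) (auto simp: h_def vabs_times vabs_divide vabs_power mult.assoc[symmetric])
    then show "integral_fps h" by (simp add: integral_fps_def)
  qed (use H01 c in \<open>simp_all add: h_def\<close>)
  have gh: "g oo h = fps_X"
    unfolding g_def h_def using c(1) H01
    by (simp add: fps_inv rescale_X flip: rescale_compose)
  have g: "integral_fps g"
    using integral_fps_left_inverse[OF h(1,2) _ gh] h(3) by simp
  have hF: "h oo F = fps_const (fps_nth f 1) * h"
    unfolding h_def F_def using c(1) f(1) Hf by (simp add: rescale_mult_const flip: rescale_compose)
  have F: "integral_fps F" "fps_nth F 0 = 0"
  proof -
    have "vabs (fps_nth F n) \<le> 1" for n
    proof (cases n)
      case (Suc m)
      then have "vabs (fps_nth F n) = vabs (fps_nth f n) * vabs c ^ m"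
        using c(1) by (simp add: F_def vabs_times vabs_divide vabs_power)
      also have "\<dots> \<le> 1 * 1"
        using f(2) c(2) by (intro mult_mono power_le_one) (auto simp: integral_fps_def)
      finally show ?thesis by simp
    qed (simp add: F_def f(1))
    then show "integral_fps F" by (simp add: integral_fps_def)
  qed (simp add: F_def f(1))
  have main: "converges_at f x \<and> fps_value f x \<in> ball 0 (vabs c) \<and> converges_at ?H x \<and>
      fps_value ?H (fps_value f x) = fps_nth f 1 * fps_value ?H x \<and>
      converges_at (fps_inv ?H) (fps_value ?H x) \<and> fps_value (fps_inv ?H) (fps_value ?H x) = x"
    if x: "x \<in> ball 0 (vabs c)" for x
  proof -
    have xc: "vabs x < vabs c" using x by (simp add: dist_vabs vabs_minus)
    define z where "z = x / c"
    have z: "x = c * z" "vabs z < 1" using xc c(1) by (auto simp: z_def vabs_divide)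
    have fx: "converges_at f x" using converges_at_integral[OF f(2)] xc c(2) by simp
    have Fz: "fps_value F z = fps_value f x / c"
      unfolding F_def z(1) using fps_value_rescale(2)[OF c(1), of f z] fx z(1) by simp
    have Fz1: "vabs (fps_value F z) \<le> vabs z"
      by (rule vabs_fps_value_integral_le[OF F z(2)])
    have fxc: "fps_value f x = c * fps_value F z" using Fz c(1) by simp
    have hz: "converges_at h z" by (rule converges_at_integral[OF h(1) z(2)])
    have Hx: "converges_at ?H x" using hz fps_value_rescale(1)[OF c(1)] by (simp add: h_def z(1))
    have Hxc: "fps_value ?H x = c * fps_value h z"
      using fps_value_rescale(2)[OF c(1), of ?H z] Hx c(1) by (simp add: h_def z(1))
    have hz1: "vabs (fps_value h z) < 1"
      using vabs_fps_value_integral_le[OF h(1,2) z(2)] z(2) by linarith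
    have "converges_at h (fps_value F z)"
      using Fz1 z(2) by (intro converges_at_integral[OF h(1)]) simp
    then have "fps_value ?H (fps_value f x) = c * fps_value h (fps_value F z)"
      using fps_value_rescale[OF c(1), of ?H "fps_value F z"] c(1) by (simp add: h_def fxc)
    also have "fps_value h (fps_value F z) = fps_value (fps_const (fps_nth f 1) * h) z"
      using fps_value_compose[OF h(1) F z(2)] hF by simp
    also have "\<dots> = fps_nth f 1 * fps_value h z"
      using fps_value_mult(2)[OF fps_value_const(1) hz] by simp
    finally have conj: "fps_value ?H (fps_value f x) = fps_nth f 1 * fps_value ?H x"
      by (simp add: Hxc)
    have ghz: "converges_at g (fps_value h z)" by (rule converges_at_integral[OF g hz1])
    have inv: "converges_at (fps_inv ?H) (fps_value ?H x)"
      using ghz fps_value_rescale(1)[OF c(1)] by (simp add: g_def Hxc)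
    have "fps_value g (fps_value h z) = z"
      using fps_value_compose[OF g h(1,2) z(2)] gh by simp
    then have "fps_value (fps_inv ?H) (fps_value ?H x) = x"
      using fps_value_rescale(2)[OF c(1), of "fps_inv ?H" "fps_value h z"] inv[unfolded Hxc] c(1)
      unfolding Hxc by (simp add: g_def z(1) field_simps)
    moreover have "vabs (fps_value f x) < vabs c"
    proof -
      have "vabs c * vabs (fps_value F z) \<le> vabs c * vabs z" using Fz1 by (intro mult_left_mono) auto
      then show ?thesis using xc[unfolded z(1) vabs_times] by (simp add: fxc vabs_times)
    qed
    ultimately show ?thesis
      using fx Hx conj inv by (simp add: dist_vabs)
  qed
  show ?thesis
    unfolding conjugate_to_linear_on_def Let_def using main by blast
qed

section \<open>Coefficients on a disk of injectivity\<close>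

lemma vabs_attains_max:
  fixes a :: "nat \<Rightarrow> 'a :: ultrametric_field"
  assumes "a \<longlonglongrightarrow> 0" "a j \<noteq> 0"
  obtains m where "\<And>k. vabs (a k) \<le> vabs (a m)"
proof -
  obtain N where N: "vabs (a k) < vabs (a j)" if "k \<ge> N" for k
    using order_tendstoD(2)[OF assms(1)[unfolded tendsto_0_vabs_iff], of "vabs (a j)"] assms(2)
    by (auto simp: eventually_sequentially)
  have "finite ((\<lambda>k. vabs (a k)) ` {..max N j})" "(\<lambda>k. vabs (a k)) ` {..max N j} \<noteq> {}" by auto
  from Max_in[OF this] obtain m where m: "Max ((\<lambda>k. vabs (a k)) ` {..max N j}) = vabs (a m)"
    by (metis (no_types, lifting) imageE)
  have le: "vabs (a k) \<le> vabs (a m)" if "k \<le> max N j" for k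
    unfolding m[symmetric] using that by (intro Max_ge) auto
  show ?thesis
  proof
    fix k
    show "vabs (a k) \<le> vabs (a m)"
    proof (cases "k \<le> max N j")
      case False
      then have "vabs (a k) < vabs (a j)" by (intro N) simp
      also have "\<dots> \<le> vabs (a m)" by (rule le) simp
      finally show ?thesis by simp
    qed (rule le)
  qed
qed

lemma vabs_fps_value_diff_le:
  fixes q :: "'a :: {ultrametric_field, complete_space} fps"
  assumes q: "integral_fps q" "converges_at q x" "converges_at q y" and xy: "vabs x \<le> 1" "vabs y \<le> 1"
  shows "vabs (fps_value q x - fps_value q y) \<le> vabs (x - y)"
proof (rule vabs_limit_le)
  show "(\<lambda>N. (\<Sum>n<N. fps_nth q n * x ^ n) - (\<Sum>n<N. fps_nth q n * y ^ n))
      \<longlonglongrightarrow> fps_value q x - fps_value q y"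
    using q unfolding converges_at_def fps_value_def by (intro tendsto_diff summable_LIMSEQ)
  have "vabs (fps_nth q n * x ^ n - fps_nth q n * y ^ n) \<le> vabs (x - y)" for n
  proof -
    have "fps_nth q n * x ^ n - fps_nth q n * y ^ n
        = (x - y) * (fps_nth q n * (\<Sum>i<n. y ^ (n - Suc i) * x ^ i))"
      unfolding right_diff_distrib[symmetric] power_diff_sumr2[of x n y] by (simp only: mult_ac)
    also have "vabs \<dots> \<le> vabs (x - y) * 1"
      unfolding vabs_times[of "x - y"] using q(1) xy
      by (intro mult_left_mono vabs_mult_le_1 vabs_sum_le)
        (auto simp: integral_fps_def vabs_power power_le_one)
    finally show ?thesis by simp
  qed
  then show "\<forall>\<^sub>F N in sequentially.
      vabs ((\<Sum>n<N. fps_nth q n * x ^ n) - (\<Sum>n<N. fps_nth q n * y ^ n)) \<le> vabs (x - y)"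
    by (intro always_eventually allI) (auto simp flip: sum_subtractf intro!: vabs_sum_le)
qed

text \<open>
  Modulo the maximal ideal, \<open>q\<close> is a polynomial of positive degree, and so is its difference with
  \<open>y\<close>. It lifts to a polynomial over the dense algebraically closed subfield, which has a root; the
  root is integral because the leading coefficient is a unit.
\<close>

lemma unit_disk_approximate_solution:
  fixes q :: "'a :: {ultrametric_field, complete_space} fps" and L :: "'a set"
  assumes L: "is_algebraic_closure F L" "closure L = UNIV"
    and q: "integral_fps q" "fps_nth q \<longlonglongrightarrow> 0" "k \<ge> 1" "vabs (fps_nth q k) = 1" and y: "vabs y \<le> 1"
  obtains z where "vabs z \<le> 1" "vabs (fps_value q z - y) < 1"
proof -
  define a where "a n = (if n = 0 then fps_nth q n - y else fps_nth q n)" for n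
  obtain N where N: "vabs (fps_nth q n) < 1" if "n \<ge> N" for n
    using order_tendstoD(2)[OF q(2)[unfolded tendsto_0_vabs_iff], of 1]
    by (auto simp: eventually_sequentially)
  define d where "d = Max {n. vabs (fps_nth q n) = 1}"
  have fin: "finite {n. vabs (fps_nth q n) = 1}"
    by (rule finite_subset[of _ "{..N}"]) (use N linear in \<open>auto simp: less_le\<close>)
  have d: "vabs (fps_nth q d) = 1" "d \<ge> 1"
    using Max_in[OF fin] Max_ge[OF fin, of k] q(3,4) by (auto simp: d_def)
  have above: "vabs (fps_nth q n) < 1" if "n > d" for n
  proof -
    have "vabs (fps_nth q n) \<noteq> 1" using Max_ge[OF fin, of n] that by (auto simp: d_def)
    then show ?thesis using q(1) by (auto simp: integral_fps_def less_le)
  qed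
  have a1: "vabs (a n) \<le> 1" for n
    using q(1) y by (auto simp: a_def integral_fps_def intro: vabs_diff_le)
  have "\<exists>b. b \<in> L \<and> vabs (a n - b) < 1" for n
  proof -
    have "a n \<in> closure L" using L(2) by simp
    then obtain b where "b \<in> L" "dist b (a n) < 1"
      unfolding closure_approachable by (meson zero_less_one)
    then show ?thesis by (auto simp: dist_vabs vabs_diff_commute)
  qed
  then obtain b where b: "\<And>n. b n \<in> L" "\<And>n. vabs (a n - b n) < 1" by metis
  have b1: "vabs (b n) \<le> 1" for n
    using vabs_diff_le_max[of "a n" "a n - b n"] a1[of n] b(2)[of n] by simp
  have bd: "vabs (b d) = 1"
    using vabs_eq_of_close[of "b d" "a d"] b(2)[of d] d by (simp add: a_def vabs_diff_commute)
  define Q where "Q = Poly (map b [0..<Suc d])"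
  have cQ: "coeff Q n = (if n \<le> d then b n else 0)" for n
    by (auto simp: Q_def nth_default_def simp del: upt_Suc)
  have "b d \<noteq> 0" using bd by auto
  then have degQ: "degree Q = d"
    by (intro antisym degree_le le_degree) (auto simp: cQ)
  have "0 \<in> L"
  proof -
    have "1 - 1 \<in> L" using L(1) unfolding is_algebraic_closure_def by blast
    then show ?thesis by simp
  qed
  then have "\<forall>n. coeff Q n \<in> L" "degree Q > 0"
    using b(1) degQ d(2) by (auto simp: cQ)
  then obtain z where z: "z \<in> L" "poly Q z = 0"
    using L(1) unfolding is_algebraic_closure_def by blast
  have z1: "vabs z \<le> 1"
  proof (rule ccontr)
    assume "\<not> vabs z \<le> 1"
    then have zg: "vabs z > 1" by simp
    have "b d * z ^ d = poly Q z - (\<Sum>n<d. b n * z ^ n)"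
      unfolding poly_altdef degQ by (simp add: cQ lessThan_Suc_atMost[symmetric])
    also have "vabs \<dots> \<le> vabs z ^ (d - 1)"
    proof -
      have "vabs (\<Sum>n<d. b n * z ^ n) \<le> vabs z ^ (d - 1)"
      proof (rule vabs_sum_le)
        fix n assume "n \<in> {..<d}"
        then have "vabs (b n) * vabs z ^ n \<le> 1 * vabs z ^ (d - 1)"
          using zg b1 by (intro mult_mono power_increasing) auto
        then show "vabs (b n * z ^ n) \<le> vabs z ^ (d - 1)" by (simp add: vabs_times vabs_power)
      qed simp
      then show ?thesis by (simp add: z(2))
    qed
    also have "\<dots> < vabs z ^ d" using zg d(2) by (intro power_strict_increasing) auto
    finally show False using bd by (simp add: vabs_times vabs_power)
  qed
  have conv: "converges_at q z" by (rule converges_at_unit_disk[OF q(2) z1])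
  then have "(\<lambda>N. \<Sum>n<N. fps_nth q n * z ^ n) \<longlonglongrightarrow> fps_value q z"
    unfolding converges_at_def fps_value_def by (rule summable_LIMSEQ)
  then have "\<forall>\<^sub>F N in sequentially. vabs ((\<Sum>n<N. fps_nth q n * z ^ n) - fps_value q z) < 1"
    using tendstoD[of "\<lambda>N. \<Sum>n<N. fps_nth q n * z ^ n" "fps_value q z" sequentially 1] by (simp add: dist_vabs)
  then have "\<forall>\<^sub>F N in sequentially. N > d \<and> vabs ((\<Sum>n<N. fps_nth q n * z ^ n) - fps_value q z) < 1"
    using eventually_gt_at_top[of d] by eventually_elim auto
  then obtain M where M: "M > d" "vabs ((\<Sum>n<M. fps_nth q n * z ^ n) - fps_value q z) < 1"
    unfolding eventually_sequentially by blast
  have "(\<Sum>n<M. fps_nth q n * z ^ n) - y = (\<Sum>n<M. a n * z ^ n)"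
  proof -
    obtain M' where M': "M = Suc M'" using M(1) by (cases M) auto
    show ?thesis
      unfolding M' sum.lessThan_Suc_shift by (simp add: a_def)
  qed
  also have "\<dots> = (\<Sum>n<M. a n * z ^ n) - poly Q z" by (simp add: z(2))
  also have "poly Q z = (\<Sum>n<M. coeff Q n * z ^ n)"
    unfolding poly_altdef degQ using M(1) by (intro sum.mono_neutral_left) (auto simp: cQ)
  also have "(\<Sum>n<M. a n * z ^ n) - \<dots> = (\<Sum>n<M. z ^ n * (a n - coeff Q n))"
    by (simp add: sum_subtractf algebra_simps)
  also have "vabs \<dots> < 1"
  proof (intro vabs_sum_less vabs_mult_less_1)
    fix n
    show "vabs (z ^ n) \<le> 1" using z1 by (simp add: vabs_power power_le_one)
    show "vabs (a n - coeff Q n) < 1"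
      using b(2)[of n] above[of n] d(2) by (auto simp: cQ a_def)
  qed simp
  finally have "vabs ((\<Sum>n<M. fps_nth q n * z ^ n) - y) < 1" .
  then have "vabs (((\<Sum>n<M. fps_nth q n * z ^ n) - y) - ((\<Sum>n<M. fps_nth q n * z ^ n) - fps_value q z)) < 1"
    using M(2) by (rule vabs_diff_less)
  then show ?thesis using that[OF z1] by simp
qed

text \<open>
  Put \<open>x\<close> to \<open>1\<close> by a homothety and let \<open>h\<close>, \<open>g\<close> be the linearization and its inverse in the new
  coordinate. If \<open>h\<close> had a coefficient of absolute value greater than \<open>1\<close>, its values on the closed
  unit disk would meet every residue class of a strictly larger disk, of radius \<open>\<bar>h m\<bar>\<close>. On that
  disk \<open>g\<close> converges, its linear term makes it take values of absolute value at least \<open>\<bar>h m\<bar>\<close>, and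
  it does so on a whole residue class. This contradicts \<open>g (h z) = z\<close> for \<open>z\<close> in the unit disk.
\<close>

lemma linearization_coeff_le_on_disk:
  fixes f :: "'a :: {ultrametric_field, complete_space} fps" and L :: "'a set"
  assumes L: "is_algebraic_closure F L" "closure L = UNIV"
    and H: "is_linearization f (linearization f)"
    and U: "disk_about_zero U" "conjugate_to_linear_on f U" and x: "x \<in> U"
  shows "vabs (fps_nth (linearization f) (Suc n)) * vabs x ^ n \<le> 1"
proof (cases "x = 0")
  case True
  then show ?thesis using H by (cases n) (auto simp: is_linearization_def)
next
  case False
  let ?H = "linearization f"
  define h g where "h = rescale x ?H" and "g = rescale x (fps_inv ?H)"
  have H01: "fps_nth ?H 0 = 0" "fps_nth ?H 1 = 1"
    using H by (auto simp: is_linearization_def)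
  have h01: "fps_nth h 0 = 0" "fps_nth h 1 = 1"
    using H01 False by (auto simp: h_def)
  have "x * z \<in> U" if "vabs z \<le> 1" for z
  proof -
    have "vabs (x * z) \<le> vabs x" using that by (simp add: vabs_times mult_left_le)
    then show ?thesis
      using U(1) x unfolding disk_about_zero_def by (auto simp: dist_vabs)
  qed
  then have conj: "converges_at ?H (x * z)" "converges_at (fps_inv ?H) (fps_value ?H (x * z))"
    "fps_value (fps_inv ?H) (fps_value ?H (x * z)) = x * z" if "vabs z \<le> 1" for z
    using U(2) that unfolding conjugate_to_linear_on_def Let_def by blast+
  have hz: "converges_at h z" "x * fps_value h z = fps_value ?H (x * z)" if "vabs z \<le> 1" for z
    using fps_value_rescale[OF False, of ?H z] conj(1)[OF that] False by (auto simp: h_def)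
  have gz: "converges_at g (fps_value h z)" "fps_value g (fps_value h z) = z" if "vabs z \<le> 1" for z
  proof -
    show "converges_at g (fps_value h z)"
      unfolding g_def fps_value_rescale(1)[OF False] hz(2)[OF that] by (rule conj(2)[OF that])
    show "fps_value g (fps_value h z) = z"
      unfolding g_def using fps_value_rescale(2)[OF False, of "fps_inv ?H" "fps_value h z"]
        conj(2,3)[OF that] hz(2)[OF that] False by simp
  qed
  have h_lim: "fps_nth h \<longlonglongrightarrow> 0"
    using hz(1)[of 1] by (simp add: converges_at_iff)
  have g1: "fps_nth g 0 = 0" "fps_nth g 1 = 1"
  proof -
    show "fps_nth g 0 = 0" by (simp add: g_def fps_inv_def)
    have "fps_nth (fps_inv ?H oo ?H) 1 = 1"
      using fps_inv[of ?H] H01 by simp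
    then show "fps_nth g 1 = 1"
      using H01 False by (simp add: g_def fps_compose_nth)
  qed
  obtain m where m: "\<And>k. vabs (fps_nth h k) \<le> vabs (fps_nth h m)"
    using vabs_attains_max[OF h_lim, of 1] h01(2) by auto
  define M where "M = fps_nth h m"
  have "vabs M \<le> 1"
  proof (rule ccontr)
    assume "\<not> vabs M \<le> 1"
    then have M: "vabs M > 1" "M \<noteq> 0" by auto
    have "m \<noteq> 0" using h01(1) M(2) unfolding M_def by metis
    then have m1: "m \<ge> 1" by simp
    define q where "q = fps_const (inverse M) * h"
    have q: "integral_fps q" "fps_nth q \<longlonglongrightarrow> 0" "vabs (fps_nth q m) = 1"
    proof -
      show "integral_fps q"
        unfolding integral_fps_def
      proof
        fix k
        show "vabs (fps_nth q k) \<le> 1"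
          using m[of k] M(1) by (simp add: q_def vabs_divide divide_le_eq flip: M_def divide_inverse_commute)
      qed
      show "fps_nth q \<longlonglongrightarrow> 0"
        using tendsto_mult[OF tendsto_const h_lim, of "inverse M"]
        unfolding q_def fps_mult_left_const_nth[abs_def] by simp
      show "vabs (fps_nth q m) = 1"
        using M(2) by (simp add: q_def flip: M_def)
    qed
    have qz: "converges_at q z" "M * fps_value q z = fps_value h z" if "vabs z \<le> 1" for z
      using fps_value_mult[OF fps_value_const(1) hz(1)[OF that], of "inverse M"] M(2)
      by (auto simp: q_def)
    have q_le: "vabs (fps_value q z) \<le> 1" if "vabs z \<le> 1" for z
    proof (rule vabs_fps_value_le[OF qz(1)[OF that]])
      fix n
      show "vabs (fps_nth q n) * vabs z ^ n \<le> 1"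
        using q(1) that by (intro mult_le_one power_le_one) (auto simp: integral_fps_def)
    qed
    \<comment> \<open>At a point where \<open>\<bar>h z1\<bar> = \<bar>M\<bar>\<close>, convergence of \<open>g\<close> gives convergence on the whole disk.\<close>
    obtain z1 where z1: "vabs z1 \<le> 1" "vabs (fps_value q z1 - 1) < 1"
      using unit_disk_approximate_solution[OF L q(1,2) m1 q(3), of 1] by auto
    define G where "G = rescale M g"
    have "converges_at G (fps_value q z1)"
      unfolding G_def fps_value_rescale(1)[OF M(2)] qz(2)[OF z1(1)] by (rule gz(1)[OF z1(1)])
    then have "(\<lambda>n. vabs (fps_nth G n * fps_value q z1 ^ n)) \<longlonglongrightarrow> 0"
      unfolding converges_at_iff tendsto_0_vabs_iff .
    then have G_lim: "fps_nth G \<longlonglongrightarrow> 0"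
      unfolding tendsto_0_vabs_iff by (simp add: vabs_times vabs_power vabs_eq_1_of_close_1[OF z1(2)])
    have G01: "fps_nth G 0 = 0" "fps_nth G 1 = 1"
      using g1 M(2) by (auto simp: G_def)
    obtain e where e: "\<And>k. vabs (fps_nth G k) \<le> vabs (fps_nth G e)"
      using vabs_attains_max[OF G_lim, of 1] G01(2) by auto
    define E where "E = fps_nth G e"
    have E: "vabs E \<ge> 1" "E \<noteq> 0" using e[of 1] G01(2) by (auto simp: E_def)
    have "e \<noteq> 0" using G01(1) E(2) unfolding E_def by metis
    then have e1: "e \<ge> 1" by simp
    define Q where "Q = fps_const (inverse E) * G"
    have Q: "integral_fps Q" "fps_nth Q \<longlonglongrightarrow> 0" "vabs (fps_nth Q e) = 1"
    proof -
      show "integral_fps Q"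
        unfolding integral_fps_def
      proof
        fix k
        show "vabs (fps_nth Q k) \<le> 1"
          using e[of k] E(1) by (simp add: Q_def vabs_divide divide_le_eq flip: E_def divide_inverse_commute)
      qed
      show "fps_nth Q \<longlonglongrightarrow> 0"
        using tendsto_mult[OF tendsto_const G_lim, of "inverse E"]
        unfolding Q_def fps_mult_left_const_nth[abs_def] by simp
      show "vabs (fps_nth Q e) = 1"
        using E(2) by (simp add: Q_def flip: E_def)
    qed
    \<comment> \<open>Around \<open>y\<close> the series \<open>G\<close> takes its maximal absolute value, and \<open>q\<close> maps some \<open>z\<close> there.\<close>
    obtain y where y: "vabs y \<le> 1" "vabs (fps_value Q y - 1) < 1"
      using unit_disk_approximate_solution[OF L Q(1,2) e1 Q(3), of 1] by auto
    obtain z where z: "vabs z \<le> 1" "vabs (fps_value q z - y) < 1"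
      using unit_disk_approximate_solution[OF L q(1,2) m1 q(3) y(1)] by auto
    let ?w = "fps_value q z"
    have w: "vabs ?w \<le> 1" by (rule q_le[OF z(1)])
    have "vabs (fps_value Q ?w - fps_value Q y) < 1"
      using vabs_fps_value_diff_le[OF Q(1) converges_at_unit_disk[OF Q(2) w]
          converges_at_unit_disk[OF Q(2) y(1)] w y(1)] z(2) by linarith
    then have "vabs ((fps_value Q ?w - fps_value Q y) + (fps_value Q y - 1)) < 1"
      using y(2) by (intro vabs_add_less)
    then have "vabs (fps_value Q ?w) = 1"
      using vabs_eq_1_of_close_1[of "fps_value Q ?w"] by simp
    moreover have "fps_value Q ?w = inverse E * (z / M)"
      using fps_value_mult(2)[OF fps_value_const(1) converges_at_unit_disk[OF G_lim w], of "inverse E"]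
        fps_value_rescale[OF M(2), of g ?w] converges_at_unit_disk[OF G_lim w] gz[OF z(1)] qz(2)[OF z(1)]
      by (simp add: Q_def G_def)
    ultimately have "vabs z = vabs E * vabs M"
      using E(2) M(2) by (simp add: vabs_times vabs_inverse vabs_divide field_simps)
    also have "\<dots> > 1" using mult_right_mono[OF E(1), of "vabs M"] M(1) by simp
    finally show False using z(1) by simp
  qed
  then have "vabs (fps_nth h (Suc n)) \<le> 1"
    using m[of "Suc n"] by (simp add: M_def)
  then show ?thesis
    using False by (simp add: h_def vabs_times vabs_power vabs_divide)
qed

section \<open>The coefficient of degree p + 1 of the linearization\<close>

lemma fps_power_nth_1: "fps_nth (u ^ i) 1 = of_nat i * fps_nth u 0 ^ (i - 1) * fps_nth (u :: 'a :: field fps) 1"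
proof (induction i)
  case (Suc i)
  then show ?case
    by (cases i) (simp_all add: fps_mult_nth fps_power_zeroth algebra_simps)
qed simp

lemma fps_power_nth_2:
  "fps_nth ((u :: 'a :: field fps) ^ (i + 2)) 2 = of_nat (i + 2) * fps_nth u 0 ^ (i + 1) * fps_nth u 2
     + of_nat ((i + 2) choose 2) * fps_nth u 0 ^ i * (fps_nth u 1)\<^sup>2"
proof (induction i)
  case 0
  show ?case
    by (simp add: fps_mult_nth numeral_2_eq_2 algebra_simps power2_eq_square)
next
  case (Suc i)
  have "fps_nth (u ^ (Suc i + 2)) 2 = fps_nth u 0 * fps_nth (u ^ (i + 2)) 2
      + fps_nth u 1 * fps_nth (u ^ (i + 2)) 1 + fps_nth u 2 * fps_nth u 0 ^ (i + 2)"
    by (simp add: fps_mult_nth[of u] numeral_2_eq_2 fps_power_zeroth flip: power_Suc2)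
  moreover have "(Suc i + 2) choose 2 = ((i + 2) choose 2) + (i + 2)"
    by (simp add: numeral_2_eq_2)
  ultimately show ?case
    unfolding Suc fps_power_nth_1 by (simp add: algebra_simps power2_eq_square)
qed

lemma fps_power_nth_shift:
  fixes f :: "'a :: field fps"
  assumes "fps_nth f 0 = 0"
  shows "fps_nth (f ^ i) (i + j) = fps_nth (fps_shift 1 f ^ i) j"
proof -
  have "f = fps_shift 1 f * fps_X"
    using assms by (intro fps_ext) auto
  then have "f ^ i = fps_shift 1 f ^ i * fps_X ^ i"
    by (metis power_mult_distrib)
  then show ?thesis by (simp add: fps_X_power_mult_right_nth)
qed

text \<open>
  In the recurrence for the coefficient of degree \<open>n + 1\<close>, the term with \<open>i = n\<close> has the largest denominator \<open>(1 - \<lambda>) ^ (n - 1)\<close>, and its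
  numerator \<open>n * \<lambda> ^ (n - 1) * a\<^sub>2\<close> is a unit as long as \<open>n < p\<close>.
\<close>

lemma vabs_linearization_coeff_less_p:
  fixes f :: "'a :: ultrametric_field fps"
  assumes p: "prime p" "vabs (of_nat p :: 'a) = 1 / real p"
    and f: "fps_nth f 0 = 0" "integral_fps f" "vabs (fps_nth f 2) = 1"
    and lam: "vabs (fps_nth f 1 - 1) < 1" "fps_nth f 1 \<noteq> 1"
    and H: "is_linearization f H" and n: "n < p"
  shows "vabs (fps_nth H (Suc n)) = (1 / vabs (fps_nth f 1 - 1)) ^ n"
  using n
proof (induction n rule: less_induct)
  case (less n)
  define e where "e = vabs (fps_nth f 1 - 1)"
  have e: "0 < e" "e < 1" using lam by (auto simp: e_def)
  then have E: "1 < 1 / e" by simp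
  show ?case
  proof (cases n)
    case 0
    then show ?thesis using H by (simp add: is_linearization_def)
  next
    case (Suc m)
    have np: "\<not> p dvd n" using less.prems Suc by (auto dest: dvd_imp_le)
    have IH: "vabs (fps_nth H (Suc j)) = (1 / e) ^ j" if "j < n" for j
      using less.IH[of j] less.prems that by (simp add: e_def)
    have "fps_nth (f ^ n) (Suc n) = of_nat n * fps_nth f 1 ^ m * fps_nth f 2"
      using fps_power_nth_shift[OF f(1), of n 1] fps_power_nth_1[of "fps_shift 1 f" n] Suc
      by (simp add: numeral_2_eq_2)
    then have "vabs (fps_nth (f ^ n) (Suc n)) = 1"
      using vabs_of_nat_coprime[OF p np] vabs_eq_1_of_close_1[OF lam(1)] f(3)
      by (simp add: vabs_times vabs_power)
    then have main: "vabs (fps_nth H n * fps_nth (f ^ n) (Suc n)) = (1 / e) ^ m"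
      using IH[of m] Suc by (simp add: vabs_times)
    have "vabs (\<Sum>i<n. fps_nth H i * fps_nth (f ^ i) (Suc n)) < (1 / e) ^ m"
    proof (rule vabs_sum_less)
      fix i assume i: "i \<in> {..<n}"
      show "vabs (fps_nth H i * fps_nth (f ^ i) (Suc n)) < (1 / e) ^ m"
      proof (cases i)
        case 0
        then show ?thesis using H e by (simp add: is_linearization_def)
      next
        case (Suc j)
        have "vabs (fps_nth H i) * vabs (fps_nth (f ^ i) (Suc n)) \<le> (1 / e) ^ j * 1"
          using IH[of j] i Suc integral_fps_power[OF f(2), of i] e
          by (intro mult_mono) (auto simp: integral_fps_def)
        also have "\<dots> < (1 / e) ^ m * 1"
          using E i Suc \<open>n = Suc m\<close> by (intro mult_strict_right_mono power_strict_increasing) auto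
        finally show ?thesis by (simp add: vabs_times)
      qed
    qed (use e in auto)
    then have "vabs (\<Sum>i<Suc n. fps_nth H i * fps_nth (f ^ i) (Suc n)) = (1 / e) ^ m"
      using vabs_eq_of_close[of "\<Sum>i<Suc n. fps_nth H i * fps_nth (f ^ i) (Suc n)"
          "fps_nth H n * fps_nth (f ^ n) (Suc n)"] main by simp
    then have "vabs (fps_nth f 1 ^ n - 1) * vabs (fps_nth H (Suc n)) = (1 / e) ^ m"
      unfolding linearization_recurrence[OF H f(1), symmetric] vabs_times
        vabs_linearization_denominator[OF lam(1)] .
    then show ?thesis
      using vabs_power_minus_1_coprime[OF p lam(1) np] e
      unfolding e_def[symmetric] Suc by (simp add: field_simps)
  qed
qed

text \<open>
  In degree \<open>p + 1\<close> the term with \<open>i = p\<close> of the recurrence carries the factor \<open>p\<close>, which is smaller than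
  \<open>1 - \<lambda>\<close>. The term with \<open>i = p - 1\<close> takes over: modulo the maximal ideal, the coefficient of degree
  \<open>p + 1\<close> in \<open>f ^ (p - 1)\<close> is \<open>(p - 1) * a\<^sub>3 + ((p - 1) choose 2) * a\<^sub>2\<^sup>2\<close>, that is \<open>a\<^sub>2\<^sup>2 - a\<^sub>3\<close>.
\<close>

lemma vabs_linearization_coeff_p_gt:
  fixes f :: "'a :: ultrametric_field fps"
  assumes p: "prime p" "p \<ge> 3" "vabs (of_nat p :: 'a) = 1 / real p"
    and f: "fps_nth f 0 = 0" "integral_fps f" "vabs (fps_nth f 2) = 1"
      "vabs ((fps_nth f 2)\<^sup>2 - fps_nth f 3) = 1"
    and lam: "1 / real p < vabs (fps_nth f 1 - 1)" "vabs (fps_nth f 1 - 1) < 1"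
    and not_root: "fps_nth f 1 ^ p \<noteq> 1"
    and H: "is_linearization f H"
  shows "(1 / vabs (fps_nth f 1 - 1)) ^ p < vabs (fps_nth H (Suc p))"
proof -
  define e where "e = vabs (fps_nth f 1 - 1)"
  have e: "0 < e" "e < 1" "1 / real p < e" using lam p(2) by (auto simp: e_def)
  then have E: "1 < 1 / e" by simp
  have lam1: "fps_nth f 1 \<noteq> 1" using not_root by auto
  have l1: "vabs (fps_nth f 1) = 1" by (rule vabs_eq_1_of_close_1[OF lam(2)])
  obtain m where m: "p = m + 3" using p(2) by (metis add.commute le_Suc_ex)
  have coeff: "vabs (fps_nth H (Suc n)) = (1 / e) ^ n" if "n < p" for n
    unfolding e_def using vabs_linearization_coeff_less_p[OF p(1,3) f(1-3) lam(2) lam1 H that] .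
  let ?u = "fps_shift 1 f"
  let ?c = "fps_nth (f ^ (m + 2)) (Suc p)"
  have small_p: "vabs (of_nat p :: 'a) < 1" using p by simp
  have c: "vabs ?c = 1"
  proof -
    define l where "l = fps_nth f 1"
    define a where "a = fps_nth f 2"
    define b where "b = fps_nth f 3"
    have "?c = of_nat (m + 2) * l ^ (m + 1) * b + of_nat ((m + 2) choose 2) * l ^ m * a\<^sup>2"
      using fps_power_nth_shift[OF f(1), of "m + 2" 2] fps_power_nth_2[of ?u m]
      by (simp add: m l_def a_def b_def numeral_2_eq_2 numeral_3_eq_3)
    also have "\<dots> - (a\<^sup>2 - b) = b * (of_nat p * l ^ (m + 1) - (l ^ (m + 1) - 1))
        + a\<^sup>2 * ((of_nat ((m + 2) choose 2) - 1) * l ^ m + (l ^ m - 1))"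
      by (simp add: m algebra_simps)
    also have "vabs \<dots> < 1"
    proof -
      have ll: "vabs (l ^ k - 1) < 1" for k
        using vabs_power_minus_1_le[of l k] l1 lam(2) by (simp add: l_def)
      have lk: "vabs (l ^ k) \<le> 1" for k
        using l1 by (simp add: l_def vabs_power)
      have "vabs (l ^ (m + 1) * of_nat p) < 1"
        by (rule vabs_mult_less_1[OF lk small_p])
      then have 1: "vabs (of_nat p * l ^ (m + 1) - (l ^ (m + 1) - 1)) < 1"
        by (intro vabs_diff_less[OF _ ll]) (simp add: mult.commute)
      have "\<exists>k. (m + 2) choose 2 = p * k + 1"
      proof -
        have "odd p" using p(1,2) prime_odd_nat[of p] by auto
        then have "even m" using m by simp
        then obtain j where j: "m = 2 * j" by (rule evenE)
        have "(2 * j + 2) * (2 * j + 2 - 1) = 2 * ((2 * j + 3) * j + 1)"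
          by (simp add: algebra_simps)
        then have "(m + 2) choose 2 = (2 * j + 3) * j + 1"
          unfolding j choose_two by simp
        then show ?thesis using j m by auto
      qed
      then obtain k where k: "(m + 2) choose 2 = p * k + 1" by blast
      have "of_nat ((m + 2) choose 2) - 1 = (of_nat k * of_nat p :: 'a)"
        unfolding k by simp
      then have "vabs (of_nat ((m + 2) choose 2) - 1 :: 'a) < 1"
        using vabs_mult_less_1[OF vabs_of_nat_le small_p] by metis
      then have "vabs (l ^ m * (of_nat ((m + 2) choose 2) - 1)) < 1"
        by (rule vabs_mult_less_1[OF lk])
      then have 2: "vabs ((of_nat ((m + 2) choose 2) - 1) * l ^ m + (l ^ m - 1)) < 1"
        by (intro vabs_add_less[OF _ ll]) (simp add: mult.commute)
      show ?thesis
        using f(2,3) by (intro vabs_add_less vabs_mult_less_1[OF _ 1] vabs_mult_less_1[OF _ 2])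
          (auto simp: integral_fps_def a_def b_def vabs_power)
    qed
    finally show ?thesis
      using vabs_eq_of_close[of ?c "a\<^sup>2 - b"] f(4) by (simp add: a_def b_def)
  qed
  let ?t = "\<lambda>i. fps_nth H i * fps_nth (f ^ i) (Suc p)"
  have t_le: "vabs (?t (Suc j)) \<le> (1 / e) ^ j" if "j < p" for j
    using coeff[OF that] integral_fps_power[OF f(2), of "Suc j"] e
    by (simp add: vabs_times integral_fps_def mult_left_le del: power_Suc)
  have main: "vabs (?t (m + 2)) = (1 / e) ^ (m + 1)"
    using coeff[of "m + 1"] c m by (simp add: vabs_times)
  have "vabs (?t p) < (1 / e) ^ (m + 1)"
  proof -
    have "fps_nth (f ^ p) (Suc p) = of_nat p * (fps_nth f 1 ^ (p - 1) * fps_nth f 2)"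
      using fps_power_nth_shift[OF f(1), of p 1] fps_power_nth_1[of ?u p]
      by (simp add: numeral_2_eq_2)
    then have "vabs (fps_nth (f ^ p) (Suc p)) = 1 / real p"
      using p(3) l1 f(3) by (simp add: vabs_times vabs_power)
    moreover have "vabs (fps_nth H p) = (1 / e) ^ (m + 2)"
      using coeff[of "m + 2"] m by (simp add: eval_nat_numeral)
    ultimately have "vabs (?t p) = (1 / e) ^ (m + 2) * (1 / real p)"
      by (simp add: vabs_times)
    also have "\<dots> < (1 / e) ^ (m + 2) * e"
      using e by (intro mult_strict_left_mono) auto
    also have "\<dots> = (1 / e) ^ (m + 1)" using e by simp
    finally show ?thesis .
  qed
  moreover have "vabs (\<Sum>i<m + 2. ?t i) < (1 / e) ^ (m + 1)"
  proof (rule vabs_sum_less)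
    fix i assume i: "i \<in> {..<m + 2}"
    show "vabs (?t i) < (1 / e) ^ (m + 1)"
    proof (cases i)
      case 0
      then show ?thesis using H e by (simp add: is_linearization_def)
    next
      case (Suc j)
      have "vabs (?t i) \<le> (1 / e) ^ j" using t_le[of j] i Suc m by simp
      also have "\<dots> < (1 / e) ^ (m + 1)" using E i Suc by (intro power_strict_increasing) auto
      finally show ?thesis .
    qed
  qed (use e in auto)
  ultimately have rest: "vabs ((\<Sum>i<m + 2. ?t i) + ?t p) < (1 / e) ^ (m + 1)"
    by (rule vabs_add_less[rotated])
  have "(\<Sum>i<Suc p. ?t i) = (\<Sum>i<m + 2. ?t i) + ?t (m + 2) + ?t p"
    by (simp add: m numeral_3_eq_3)
  then have "vabs (\<Sum>i<Suc p. ?t i) = (1 / e) ^ (m + 1)"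
    using vabs_eq_of_close[of "\<Sum>i<Suc p. ?t i" "?t (m + 2)"] rest main by (simp add: algebra_simps)
  then have eq: "vabs (fps_nth f 1 ^ p - 1) * vabs (fps_nth H (Suc p)) = (1 / e) ^ (m + 1)"
    unfolding linearization_recurrence[OF H f(1), symmetric] vabs_times
      vabs_linearization_denominator[OF lam(2)] .
  have "vabs (fps_nth f 1 ^ p - 1) \<le> e * max (1 / real p) (e\<^sup>2)"
    unfolding e_def by (rule vabs_power_p_minus_1_le[OF p lam(2)])
  also have "\<dots> < e * e"
    using e by (intro mult_strict_left_mono) (auto simp: power2_eq_square)
  finally have lp: "vabs (fps_nth f 1 ^ p - 1) < e * e" .
  have "(1 / e) ^ p * (e * e) = (1 / e) ^ (m + 1)"
    using e by (simp add: m power_add power2_eq_square numeral_3_eq_3)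
  also have "\<dots> = vabs (fps_nth f 1 ^ p - 1) * vabs (fps_nth H (Suc p))" by (rule eq[symmetric])
  also have "\<dots> < e * e * vabs (fps_nth H (Suc p))"
  proof (rule mult_strict_right_mono[OF lp])
    have "(1 / e) ^ (m + 1) > 0" using e by simp
    then show "0 < vabs (fps_nth H (Suc p))" using eq by (cases "fps_nth H (Suc p) = 0") auto
  qed
  finally show ?thesis
    using e unfolding e_def[symmetric] by (simp add: mult.commute)
qed

section \<open>Power series modulo the maximal ideal\<close>

definition fps_cong :: "'a :: ultrametric_field fps \<Rightarrow> 'a fps \<Rightarrow> bool" where
  "fps_cong g h \<longleftrightarrow> (\<forall>n. vabs (fps_nth g n - fps_nth h n) < 1)"

lemma fps_congD: "fps_cong g h \<Longrightarrow> vabs (fps_nth g n - fps_nth h n) < 1"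
  by (simp add: fps_cong_def)

lemma fps_cong_refl [simp]: "fps_cong g g"
  by (simp add: fps_cong_def)

lemma fps_cong_trans [trans]:
  assumes "fps_cong g h" "fps_cong h k"
  shows "fps_cong g k"
  unfolding fps_cong_def
proof
  fix n
  show "vabs (fps_nth g n - fps_nth k n) < 1"
    using vabs_add_less[OF fps_congD[OF assms(1), of n] fps_congD[OF assms(2), of n]] by simp
qed

lemma fps_cong_add:
  assumes "fps_cong g g'" "fps_cong h h'"
  shows "fps_cong (g + h) (g' + h')"
  unfolding fps_cong_def
proof
  fix n
  show "vabs (fps_nth (g + h) n - fps_nth (g' + h') n) < 1"
    using vabs_add_less[OF fps_congD[OF assms(1), of n] fps_congD[OF assms(2), of n]]
    by (simp add: algebra_simps)
qed

lemma fps_cong_mult: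
  fixes g h :: "'a :: ultrametric_field fps"
  assumes gh: "fps_cong g g'" "fps_cong h h'" and int: "integral_fps g" "integral_fps h'"
  shows "fps_cong (g * h) (g' * h')"
  unfolding fps_cong_def
proof
  fix n
  have "fps_nth (g * h) n - fps_nth (g' * h') n
      = (\<Sum>i=0..n. fps_nth g i * (fps_nth h (n - i) - fps_nth h' (n - i))
          + fps_nth h' (n - i) * (fps_nth g i - fps_nth g' i))"
    by (simp add: fps_mult_nth algebra_simps flip: sum_subtractf)
  also have "vabs \<dots> < 1"
    using fps_congD[OF gh(1)] fps_congD[OF gh(2)] int
    by (intro vabs_sum_less vabs_add_less vabs_mult_less_1) (auto simp: integral_fps_def)
  finally show "vabs (fps_nth (g * h) n - fps_nth (g' * h') n) < 1" .
qed

lemma fps_cong_power: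
  fixes g :: "'a :: ultrametric_field fps"
  assumes "fps_cong g g'" "integral_fps g" "integral_fps g'"
  shows "fps_cong (g ^ m) (g' ^ m)"
  using assms by (induction m) (auto intro: fps_cong_mult integral_fps_power)

lemma fps_cong_freshmans_dream:
  fixes g h :: "'a :: ultrametric_field fps"
  assumes p: "prime p" "vabs (of_nat p :: 'a) = 1 / real p" and gh: "integral_fps g" "integral_fps h"
  shows "fps_cong ((g + h) ^ p) (g ^ p + h ^ p)"
  unfolding fps_cong_def
proof
  fix n
  have p1: "p > 1" by (rule prime_gt_1_nat[OF p(1)])
  let ?t = "\<lambda>k. of_nat (p choose k) * g ^ k * h ^ (p - k)"
  have "(g + h) ^ p = (\<Sum>k\<in>{..p}. ?t k)" by (rule binomial_ring)
  also have "{..p} = insert 0 (insert p {1..<p})" using p1 by auto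
  also have "(\<Sum>k\<in>\<dots>. ?t k) = g ^ p + h ^ p + (\<Sum>k\<in>{1..<p}. ?t k)"
    using p1 by (simp add: add_ac)
  finally have "fps_nth ((g + h) ^ p) n - fps_nth (g ^ p + h ^ p) n = (\<Sum>k\<in>{1..<p}. fps_nth (?t k) n)"
    by (simp add: fps_sum_nth)
  also have "vabs \<dots> < 1"
  proof (rule vabs_sum_less)
    fix k assume k: "k \<in> {1..<p}"
    have "vabs (of_nat (p choose k) :: 'a) \<le> 1 / real p"
      using k p(1) by (intro vabs_of_nat_dvd_le[OF p(2)] dvd_choose_prime) auto
    also have "\<dots> < 1" using p1 by simp
    finally have c: "vabs (of_nat (p choose k) :: 'a) < 1" .
    have "fps_nth (?t k) n = fps_nth (g ^ k * h ^ (p - k)) n * of_nat (p choose k)"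
      unfolding mult.assoc fps_of_nat[symmetric] fps_mult_left_const_nth by (rule mult.commute)
    then show "vabs (fps_nth (?t k) n) < 1"
      using integral_fps_mult[OF integral_fps_power[OF gh(1), of k] integral_fps_power[OF gh(2), of "p - k"]]
        vabs_mult_less_1[OF _ c] by (simp add: integral_fps_def)
  qed simp
  finally show "vabs (fps_nth ((g + h) ^ p) n - fps_nth (g ^ p + h ^ p) n) < 1" .
qed

lemma fermat_little_vabs:
  assumes p: "prime p" "vabs (of_nat p :: 'a :: ultrametric_field) = 1 / real p"
  shows "vabs (of_nat k ^ p - of_nat k :: 'a) < 1"
proof (induction k)
  case 0
  show ?case using prime_gt_0_nat[OF p(1)] by (simp add: power_0_left)
next
  case (Suc k)
  have "vabs (fps_nth ((fps_const (of_nat k) + fps_const 1) ^ p) 0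
      - fps_nth (fps_const (of_nat k) ^ p + fps_const (1 :: 'a) ^ p) 0) < 1"
    by (intro fps_congD[OF fps_cong_freshmans_dream[OF p]] integral_fps_const vabs_of_nat_le) simp
  then have "vabs ((of_nat k + 1) ^ p - (of_nat k ^ p + 1) :: 'a) < 1"
    by (simp add: fps_power_zeroth del: fps_const_1_eq_1)
  from vabs_add_less[OF this Suc] show ?case by (simp add: algebra_simps)
qed

text \<open>The image of \<open>g\<close> under the \<open>p\<close>-th power map of the residue field, with \<open>X ^ p\<close> put for \<open>X\<close>.\<close>

definition fps_frobenius :: "nat \<Rightarrow> 'a :: field fps \<Rightarrow> 'a fps" where
  "fps_frobenius p g = Abs_fps (\<lambda>n. if p dvd n then fps_nth g (n div p) ^ p else 0)"

lemma fps_power_nth_cong: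
  "\<forall>k\<le>n. fps_nth g k = fps_nth h k \<Longrightarrow> k \<le> n \<Longrightarrow> fps_nth (g ^ m) k = fps_nth ((h :: 'a :: comm_ring_1 fps) ^ m) k"
  by (induction m arbitrary: k) (auto simp: fps_mult_nth intro!: sum.cong)

lemma fps_cong_frobenius:
  fixes g :: "'a :: ultrametric_field fps"
  assumes p: "prime p" "vabs (of_nat p :: 'a) = 1 / real p" and g: "integral_fps g"
  shows "fps_cong (g ^ p) (fps_frobenius p g)"
  unfolding fps_cong_def
proof
  fix n
  have p0: "p > 0" by (rule prime_gt_0_nat[OF p(1)])
  have gj: "vabs (fps_nth g j) \<le> 1" for j using g by (simp add: integral_fps_def)
  let ?A = "\<lambda>N. \<Sum>j<N. fps_const (fps_nth g j) * fps_X ^ j"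
  let ?B = "\<lambda>N. \<Sum>j<N. fps_const (fps_nth g j ^ p) * fps_X ^ (j * p)"
  have "fps_cong (?A N ^ p) (?B N)" for N
  proof (induction N)
    case 0
    show ?case using p0 by (simp add: power_0_left)
  next
    case (Suc N)
    have "fps_cong (?A (Suc N) ^ p) (?A N ^ p + (fps_const (fps_nth g N) * fps_X ^ N) ^ p)"
      unfolding sum.lessThan_Suc
      by (intro fps_cong_freshmans_dream[OF p] integral_fps_sum integral_fps_mult integral_fps_const
          integral_fps_power integral_fps_X gj)
    also have "fps_cong \<dots> (?B N + fps_const (fps_nth g N ^ p) * fps_X ^ (N * p))"
      by (intro fps_cong_add Suc) (simp add: power_mult_distrib fps_const_power flip: power_mult)
    finally show ?case by simp
  qed
  from fps_congD[OF this[of "Suc n"], of n]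
  have "vabs (fps_nth (?A (Suc n) ^ p) n - fps_nth (?B (Suc n)) n) < 1" .
  moreover have "fps_nth (g ^ p) n = fps_nth (?A (Suc n) ^ p) n"
  proof (rule fps_power_nth_cong[of n])
    show "\<forall>k\<le>n. fps_nth g k = fps_nth (?A (Suc n)) k"
      by (auto simp: fps_sum_nth fps_X_power_nth if_distrib sum.delta cong: if_cong simp del: sum.lessThan_Suc)
  qed simp
  moreover have "fps_nth (?B (Suc n)) n = fps_nth (fps_frobenius p g) n"
  proof -
    have "fps_nth (?B (Suc n)) n = (\<Sum>j<Suc n. if n = j * p then fps_nth g j ^ p else 0)"
      by (simp add: fps_sum_nth fps_X_power_nth if_distrib cong: if_cong del: sum.lessThan_Suc)
    also have "\<dots> = (\<Sum>j<Suc n. if j = n div p \<and> p dvd n then fps_nth g j ^ p else 0)"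
      using p0 by (intro sum.cong) auto
    also have "\<dots> = fps_nth (fps_frobenius p g) n"
      by (cases "p dvd n") (auto simp: fps_frobenius_def div_le_dividend le_imp_less_Suc simp del: sum.lessThan_Suc)
    finally show ?thesis .
  qed
  ultimately show "vabs (fps_nth (g ^ p) n - fps_nth (fps_frobenius p g) n) < 1" by simp
qed

section \<open>Fixed points of linearizable series in one residue class\<close>

text \<open>
  Writing \<open>\<theta>\<close> for \<open>X * d/dX\<close>, the hypothesis says that \<open>1 / V\<close> is the logarithmic derivative
  \<open>\<theta> h / h\<close>. Multiplying by powers gives \<open>h ^ (p - 1) * \<theta> h = V ^ (p - 1) * (\<theta> h) ^ p\<close>. Compare the
  coefficients of degree divisible by \<open>p\<close>. On the right \<open>(\<theta> h) ^ p\<close> is a series in \<open>X ^ p\<close>. On the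
  left stands \<open>\<theta> (h ^ p) / p\<close>, so the coefficient of degree \<open>p * k\<close> is \<open>k\<close> times that of \<open>h ^ p\<close>,
  which is the coefficient of \<open>(\<theta> h) ^ p\<close>. Hence in degrees divisible by \<open>p\<close> the factor
  \<open>V ^ (p - 1)\<close> acts as \<open>1\<close>.
\<close>

lemma logarithmic_derivative_coeffs:
  fixes h V :: "'a :: ultrametric_field fps"
  assumes p: "prime p" "vabs (of_nat p :: 'a) = 1 / real p"
    and h: "integral_fps h" "fps_nth h 0 = 0" "fps_nth h 1 = 1" and V: "integral_fps V"
    and hV: "fps_cong h (V * (fps_X * fps_deriv h))"
  shows "vabs (fps_nth (V ^ (p - 1)) (p * i) - (if i = 0 then 1 else 0)) < 1"
proof -
  define w where "w = fps_X * fps_deriv h"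
  define W where "W = V ^ (p - 1)"
  have p0: "p > 0" by (rule prime_gt_0_nat[OF p(1)])
  have wn: "fps_nth w n = of_nat n * fps_nth h n" for n
    by (cases n) (simp_all add: w_def)
  have hn: "vabs (fps_nth h n) \<le> 1" for n using h(1) by (simp add: integral_fps_def)
  have w: "integral_fps w"
    unfolding integral_fps_def wn using hn vabs_of_nat_le by (auto intro: vabs_mult_le_1)
  have W: "integral_fps W" unfolding W_def by (rule integral_fps_power[OF V])
  have c1: "fps_cong (h ^ (p - 1) * w) (W * fps_frobenius p w)"
  proof -
    have "fps_cong (h ^ (p - 1) * w) ((V * w) ^ (p - 1) * w)"
      using hV unfolding w_def[symmetric]
      by (intro fps_cong_mult fps_cong_power fps_cong_refl h(1) w integral_fps_power integral_fps_mult V)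
    also have "(V * w) ^ (p - 1) * w = W * w ^ p"
      using p0 by (simp add: W_def power_mult_distrib mult.assoc flip: power_Suc2)
    also have "fps_cong \<dots> (W * fps_frobenius p w)"
    proof (intro fps_cong_mult fps_cong_refl fps_cong_frobenius[OF p w] W)
      show "integral_fps (fps_frobenius p w)"
        using w by (auto simp: integral_fps_def fps_frobenius_def vabs_power power_le_one)
    qed
    finally show ?thesis .
  qed
  \<comment> \<open>An identity in characteristic zero: both sides are \<open>\<theta> (h ^ p)\<close> divided by \<open>p\<close>.\<close>
  have lhs: "fps_nth (h ^ (p - 1) * w) (p * k) = of_nat k * fps_nth (h ^ p) (p * k)" for k
  proof -
    have "of_nat p * (h ^ (p - 1) * w) = fps_X * fps_deriv (h ^ p)"
      by (simp add: w_def fps_deriv_power mult_ac flip: fps_of_nat)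
    then have "fps_nth (of_nat p * (h ^ (p - 1) * w)) (p * k) = of_nat (p * k) * fps_nth (h ^ p) (p * k)"
      by (cases "p * k") (simp_all del: of_nat_mult)
    then show ?thesis using p0 by (simp add: mult.assoc flip: fps_of_nat)
  qed
  have rhs: "fps_nth (W * fps_frobenius p w) (p * k) = (\<Sum>j\<le>k. fps_nth w j ^ p * fps_nth W (p * (k - j)))" for k
  proof -
    have "fps_nth (W * fps_frobenius p w) (p * k)
        = (\<Sum>n\<in>{0..p * k}. fps_nth (fps_frobenius p w) n * fps_nth W (p * k - n))"
      by (simp add: mult.commute[of W] fps_mult_nth)
    also have "\<dots> = (\<Sum>n\<in>(*) p ` {..k}. fps_nth (fps_frobenius p w) n * fps_nth W (p * k - n))"
    proof (intro sum.mono_neutral_right ballI)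
      fix n assume "n \<in> {0..p * k} - (*) p ` {..k}"
      then have "\<not> p dvd n" using p0 by auto
      then show "fps_nth (fps_frobenius p w) n * fps_nth W (p * k - n) = 0"
        by (simp add: fps_frobenius_def)
    qed auto
    also have "\<dots> = (\<Sum>j\<le>k. fps_nth w j ^ p * fps_nth W (p * (k - j)))"
      using p0 by (subst sum.reindex) (auto simp: inj_on_def fps_frobenius_def right_diff_distrib')
    finally show ?thesis .
  qed
  \<comment> \<open>Modulo the maximal ideal \<open>k * h\<^sub>k ^ p = (k * h\<^sub>k) ^ p\<close>, by Fermat's little theorem.\<close>
  have key: "vabs (fps_nth w k ^ p - (\<Sum>j\<le>k. fps_nth w j ^ p * fps_nth W (p * (k - j)))) < 1" for k
  proof -
    have "vabs (fps_nth (h ^ p) (p * k) - fps_nth h k ^ p) < 1"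
      using fps_congD[OF fps_cong_frobenius[OF p h(1)], of "p * k"] p0 by (simp add: fps_frobenius_def)
    then have 1: "vabs (of_nat k * (fps_nth (h ^ p) (p * k) - fps_nth h k ^ p)) < 1"
      by (rule vabs_mult_less_1[OF vabs_of_nat_le])
    have 2: "vabs (fps_nth h k ^ p * (of_nat k ^ p - of_nat k)) < 1"
      using hn by (intro vabs_mult_less_1[OF _ fermat_little_vabs[OF p]]) (simp add: vabs_power power_le_one)
    have "vabs (fps_nth w k ^ p - of_nat k * fps_nth (h ^ p) (p * k)) < 1"
      using vabs_diff_less[OF 2 1] by (simp add: wn power_mult_distrib algebra_simps)
    from vabs_add_less[OF this fps_congD[OF c1, of "p * k", unfolded lhs rhs]] show ?thesis
      by simp
  qed
  have w01: "fps_nth w 0 = 0" "fps_nth w 1 = 1" using h by (simp_all add: wn)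
  have wk: "vabs (fps_nth w k ^ p) \<le> 1" for k
    using w by (simp add: vabs_power power_le_one integral_fps_def)
  \<comment> \<open>The relations \<open>key\<close> determine the coefficients of \<open>W\<close> one after the other, because \<open>w\<close> starts
      with \<open>X\<close>.\<close>
  have "vabs (fps_nth W (p * i) - (if i = 0 then 1 else 0)) < 1"
  proof (induction i rule: less_induct)
    case (less i)
    have split: "(\<Sum>j\<le>Suc i. fps_nth w j ^ p * fps_nth W (p * (Suc i - j)))
        = fps_nth W (p * i) + (\<Sum>j\<in>{2..Suc i}. fps_nth w j ^ p * fps_nth W (p * (Suc i - j)))"
    proof -
      have "{..Suc i} = insert 0 (insert 1 {2..Suc i})" by auto
      then show ?thesis using w01 p0 by simp
    qed
    show ?case
    proof (cases "i = 0")
      case True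
      then show ?thesis using key[of "Suc i"] w01 p0 split by (simp add: vabs_diff_commute power_0_left)
    next
      case False
      let ?r = "\<lambda>j. fps_nth w j ^ p * fps_nth W (p * (Suc i - j))"
      have "{2..Suc i} = insert (Suc i) {2..i}" using False by auto
      then have "fps_nth W (p * i) = fps_nth w (Suc i) ^ p * (1 - fps_nth W (p * 0)) - (\<Sum>j\<in>{2..i}. ?r j)
          - (fps_nth w (Suc i) ^ p - (\<Sum>j\<le>Suc i. ?r j))"
        unfolding split by (simp add: algebra_simps)
      also have "vabs \<dots> < 1"
      proof (rule vabs_diff_less[OF vabs_diff_less key])
        show "vabs (fps_nth w (Suc i) ^ p * (1 - fps_nth W (p * 0))) < 1"
          using less[of 0] False by (intro vabs_mult_less_1[OF wk]) (simp add: vabs_diff_commute)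
        show "vabs (\<Sum>j\<in>{2..i}. ?r j) < 1"
        proof (rule vabs_sum_less)
          fix j assume j: "j \<in> {2..i}"
          show "vabs (?r j) < 1"
            using less[of "Suc i - j"] j by (intro vabs_mult_less_1[OF wk]) (auto split: if_splits)
        qed simp
      qed
      finally show ?thesis using False by simp
    qed
  qed
  then show ?thesis by (simp add: W_def)
qed

text \<open>
  A double zero of \<open>V\<close> at \<open>1\<close> is a zero of order at least \<open>p\<close> of \<open>V ^ (p - 1)\<close>, so that
  \<open>V ^ (p - 1) = (X ^ p - 1) * T\<close> with a polynomial \<open>T\<close> over the residue field. If \<open>V ^ (p - 1)\<close> were
  \<open>1\<close> in the degrees divisible by \<open>p\<close>, then in these degrees \<open>T\<close> would be \<open>- 1 / (1 - X ^ p)\<close> and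
  so have infinitely many coefficients \<open>- 1\<close>.
\<close>

lemma no_double_zero:
  fixes V S :: "'a :: {ultrametric_field, complete_space} fps"
  assumes p: "prime p" "p \<ge> 3" "vabs (of_nat p :: 'a) = 1 / real p"
    and V: "integral_fps V" "fps_cong V ((fps_X - 1)\<^sup>2 * S)"
    and S: "integral_fps S" "fps_nth S \<longlonglongrightarrow> 0"
    and coeffs: "\<And>i. vabs (fps_nth (V ^ (p - 1)) (p * i) - (if i = 0 then 1 else 0)) < 1"
  shows False
proof -
  have p0: "p > 0" using p(2) by simp
  let ?X1 = "fps_X - 1 :: 'a fps"
  define T where "T = ?X1 ^ (p - 2) * S ^ (p - 1)"
  have X1: "integral_fps ?X1" by (intro integral_fps_diff integral_fps_X integral_fps_1)
  have T: "integral_fps T"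
    unfolding T_def by (intro integral_fps_mult integral_fps_power X1 S(1))
  have "converges_at ?X1 1"
    using fps_value_add(1)[OF fps_value_X(1) fps_value_const(1)[of "- 1"], of 1]
    by (simp flip: fps_const_neg)
  moreover have "converges_at S 1" using converges_at_unit_disk[OF S(2), of 1] by simp
  ultimately have "converges_at T 1"
    unfolding T_def by (intro fps_value_mult(1) conjunct1[OF fps_value_power])
  then have "fps_nth T \<longlonglongrightarrow> 0" by (simp add: converges_at_iff)
  then obtain N where N: "vabs (fps_nth T n) < 1" if "n \<ge> N" for n
    using order_tendstoD(2)[of "\<lambda>n. vabs (fps_nth T n)" 0 sequentially 1]
    by (auto simp: tendsto_0_vabs_iff eventually_sequentially)
  have "odd p" using p(1,2) prime_odd_nat[of p] by auto
  have X1p: "fps_cong (?X1 ^ p) (fps_X ^ p - 1)"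
    using fps_cong_freshmans_dream[OF p(1,3) integral_fps_X, of "- 1"] \<open>odd p\<close>
    by (simp add: integral_fps_def)
  have "fps_cong (V ^ (p - 1)) (((?X1)\<^sup>2 * S) ^ (p - 1))"
    by (intro fps_cong_power V integral_fps_mult integral_fps_power X1 S(1))
  also have "((?X1)\<^sup>2 * S) ^ (p - 1) = ?X1 ^ p * T"
  proof -
    have "2 * (p - 1) = p + (p - 2)" using p(2) by simp
    then show ?thesis by (simp add: T_def power_mult_distrib power_add mult.assoc flip: power_mult)
  qed
  also have "fps_cong \<dots> ((fps_X ^ p - 1) * T)"
    by (intro fps_cong_mult X1p fps_cong_refl integral_fps_power X1 T)
  finally have cong: "fps_cong (V ^ (p - 1)) ((fps_X ^ p - 1) * T)" .
  have "vabs (fps_nth T (p * i) + 1) < 1" for i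
  proof (induction i)
    case 0
    have "fps_nth ((fps_X ^ p - 1) * T) 0 = - fps_nth T 0" using p0 by simp
    then have "vabs (fps_nth (V ^ (p - 1)) 0 + fps_nth T 0) < 1"
      using fps_congD[OF cong, of 0] by simp
    from vabs_diff_less[OF this, OF coeffs[of 0, simplified]] show ?case by (simp add: algebra_simps)
  next
    case (Suc i)
    have "fps_nth ((fps_X ^ p - 1) * T) (p * Suc i) = fps_nth T (p * i) - fps_nth T (p * Suc i)"
      by (simp add: left_diff_distrib fps_X_power_mult_nth)
    then have "vabs (fps_nth (V ^ (p - 1)) (p * Suc i) - (fps_nth T (p * i) - fps_nth T (p * Suc i))) < 1"
      using fps_congD[OF cong, of "p * Suc i"] by simp
    from vabs_diff_less[OF this] have "vabs (fps_nth T (p * Suc i) - fps_nth T (p * i)) < 1"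
      using coeffs[of "Suc i"] by (force simp: algebra_simps)
    from vabs_add_less[OF this Suc] show ?case by simp
  qed
  from vabs_diff_less[OF this[of N] N[of "p * N"]] p0 show False by simp
qed

lemma fps_power_add_first_order:
  fixes A B :: "'a :: ultrametric_field fps"
  assumes "integral_fps A" "integral_fps B" "vabs d \<le> 1"
  shows "\<exists>R. integral_fps R \<and>
    (A + fps_const d * B) ^ k = A ^ k + fps_const d * (of_nat k * A ^ (k - 1) * B) + fps_const (d\<^sup>2) * R"
proof (induction k)
    case 0
    show ?case by (intro exI[of _ 0]) (simp add: integral_fps_def)
  next
    case (Suc k)
    then obtain R where R: "integral_fps R" and
      eq: "(A + fps_const d * B) ^ k = A ^ k + fps_const d * (of_nat k * A ^ (k - 1) * B) + fps_const (d\<^sup>2) * R"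
      by blast
    let ?R = "of_nat k * A ^ (k - 1) * B\<^sup>2 + R * (A + fps_const d * B)"
    have kA: "of_nat k * A ^ (k - 1) * A = of_nat k * A ^ k" by (cases k) simp_all
    have dd: "fps_const (d\<^sup>2) = fps_const d * fps_const d" by (simp add: power2_eq_square)
    have "(A + fps_const d * B) ^ Suc k = A ^ k * A + fps_const d * ((of_nat k * A ^ (k - 1) * A + A ^ k) * B)
        + fps_const (d\<^sup>2) * ?R"
      unfolding power_Suc2 eq dd by (simp add: algebra_simps power2_eq_square)
    also have "of_nat k * A ^ (k - 1) * A + A ^ k = of_nat (Suc k) * A ^ (Suc k - 1)"
      unfolding kA by (simp add: algebra_simps)
    finally have "(A + fps_const d * B) ^ Suc k
        = A ^ Suc k + fps_const d * (of_nat (Suc k) * A ^ (Suc k - 1) * B) + fps_const (d\<^sup>2) * ?R"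
      by (simp only: power_Suc2)
    moreover have "integral_fps ?R"
      unfolding fps_of_nat[symmetric]
      by (intro integral_fps_add integral_fps_mult integral_fps_power integral_fps_const vabs_of_nat_le assms R)
    ultimately show ?case by blast
qed

text \<open>
  As \<open>G\<close> is conjugate to multiplication by \<open>\<Lambda>\<close> over the ring of integers, it is congruent to the
  identity modulo \<open>\<Lambda> - 1\<close>; the quotient \<open>X * V\<close> is its infinitesimal generator, up to a factor and
  modulo the maximal ideal. The congruence is the first-order part of \<open>h \<circ> G = \<Lambda> * h\<close>.
\<close>

lemma linearizable_infinitesimal_generator:
  fixes G h :: "'a :: ultrametric_field fps"
  assumes L: "vabs (\<Lambda> - 1) < 1" "\<Lambda> \<noteq> 1"
    and G: "fps_nth G 0 = 0" "fps_nth G \<longlonglongrightarrow> 0"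
    and h: "integral_fps h" "fps_nth h 0 = 0" "fps_nth h 1 = 1"
    and conj: "h oo G = fps_const \<Lambda> * h"
  obtains V where "integral_fps V" "fps_nth V \<longlonglongrightarrow> 0"
    "G = fps_X + fps_const (\<Lambda> - 1) * (fps_X * V)" "fps_cong h (V * (fps_X * fps_deriv h))"
proof -
  define d where "d = \<Lambda> - 1"
  have d: "d \<noteq> 0" "vabs d < 1" using L by (auto simp: d_def)
  define g where "g = fps_inv h"
  have gh: "g oo h = fps_X" unfolding g_def using h by (intro fps_inv) auto
  have g: "integral_fps g" using integral_fps_left_inverse[OF h(1,2) _ gh] h(3) by simp
  have close: "vabs (fps_nth G n - fps_nth fps_X n) \<le> vabs d" for n
  proof -
    have "G = (g oo h) oo G" using G(1) by (simp add: gh)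
    also have "\<dots> = g oo (h oo G)" using G(1) h(2) by (intro fps_compose_assoc[symmetric])
    finally have "fps_nth G n = fps_nth (g oo (fps_const \<Lambda> * h)) n" by (simp add: conj)
    moreover have "fps_nth fps_X n = fps_nth (g oo h) n" by (simp add: gh)
    ultimately have "fps_nth G n - fps_nth fps_X n
        = (\<Sum>k=0..n. (\<Lambda> ^ k - 1) * (fps_nth g k * fps_nth (h ^ k) n))"
      by (simp add: fps_compose_nth power_mult_distrib fps_const_power algebra_simps flip: sum_subtractf)
    also have "vabs \<dots> \<le> vabs d"
    proof (rule vabs_sum_le)
      fix k
      have "vabs (\<Lambda> ^ k - 1) * vabs (fps_nth g k * fps_nth (h ^ k) n) \<le> vabs d * 1"
        using g integral_fps_power[OF h(1), of k] vabs_power_minus_1_le[of \<Lambda> k]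
          vabs_eq_1_of_close_1[OF L(1)] unfolding d_def
        by (intro mult_mono vabs_mult_le_1) (auto simp: integral_fps_def)
      then show "vabs ((\<Lambda> ^ k - 1) * (fps_nth g k * fps_nth (h ^ k) n)) \<le> vabs d"
        by (simp add: vabs_times)
    qed simp
    finally show ?thesis .
  qed
  define V where "V = Abs_fps (\<lambda>n. (fps_nth G (Suc n) - fps_nth fps_X (Suc n)) / d)"
  have V: "integral_fps V"
    unfolding integral_fps_def
  proof
    fix n
    show "vabs (fps_nth V n) \<le> 1"
      using close[of "Suc n"] d(1) by (simp add: V_def vabs_divide divide_le_eq)
  qed
  have "(\<lambda>n. inverse d * fps_nth G (n + 2)) \<longlonglongrightarrow> inverse d * 0"
    by (intro tendsto_mult tendsto_const LIMSEQ_ignore_initial_segment[OF G(2)])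
  moreover have "(\<lambda>n. inverse d * fps_nth G (n + 2)) = (\<lambda>n. fps_nth V (n + 1))"
    by (simp add: fun_eq_iff V_def divide_inverse mult.commute)
  ultimately have "(\<lambda>n. fps_nth V (n + 1)) \<longlonglongrightarrow> 0" by (simp only: mult_zero_right)
  then have V_lim: "fps_nth V \<longlonglongrightarrow> 0" by (rule LIMSEQ_offset)
  have G_eq: "G = fps_X + fps_const d * (fps_X * V)"
  proof (rule fps_ext)
    fix n
    show "fps_nth G n = fps_nth (fps_X + fps_const d * (fps_X * V)) n"
      using G(1) d(1) by (cases n) (simp_all add: V_def)
  qed
  let ?B = "fps_X * V"
  have B: "integral_fps ?B" by (intro integral_fps_mult integral_fps_X V)
  have "\<exists>R. \<forall>k. integral_fps (R k) \<and>
      G ^ k = fps_X ^ k + fps_const d * (of_nat k * fps_X ^ (k - 1) * ?B) + fps_const (d\<^sup>2) * R k"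
    using fps_power_add_first_order[OF integral_fps_X B less_imp_le[OF d(2)]]
    unfolding G_eq[symmetric] by (intro choice allI)
  then obtain R where R: "\<And>k. integral_fps (R k)" and
    Gk: "\<And>k. G ^ k = fps_X ^ k + fps_const d * (of_nat k * fps_X ^ (k - 1) * ?B) + fps_const (d\<^sup>2) * R k"
    by blast
  have deriv: "(\<Sum>k=0..n. fps_nth h k * fps_nth (of_nat k * fps_X ^ (k - 1) * ?B) n)
      = fps_nth (V * (fps_X * fps_deriv h)) n" for n
  proof -
    have t: "fps_nth (of_nat k * fps_X ^ (k - 1) * ?B) n = of_nat k * fps_nth V (n - k)"
      if k: "k \<noteq> 0" "k \<le> n" for k
    proof -
      obtain j where j: "k = Suc j" using k(1) by (cases k) auto
      have "fps_X ^ (k - 1) * ?B = fps_X ^ k * V" by (simp add: j mult_ac)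
      then show ?thesis
        using k by (simp add: mult.assoc fps_X_power_mult_nth flip: fps_of_nat)
    qed
    have "(\<Sum>k=0..n. fps_nth h k * fps_nth (of_nat k * fps_X ^ (k - 1) * ?B) n)
        = (\<Sum>k=0..n. fps_nth (fps_X * fps_deriv h) k * fps_nth V (n - k))"
    proof (rule sum.cong)
      fix k assume k: "k \<in> {0..n}"
      show "fps_nth h k * fps_nth (of_nat k * fps_X ^ (k - 1) * ?B) n
          = fps_nth (fps_X * fps_deriv h) k * fps_nth V (n - k)"
        using t[of k] k by (cases k) (simp_all del: of_nat_Suc)
    qed simp
    also have "\<dots> = fps_nth (V * (fps_X * fps_deriv h)) n"
      by (subst mult.commute) (simp only: fps_mult_nth)
    finally show ?thesis .
  qed
  have "fps_cong h (V * (fps_X * fps_deriv h))"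
    unfolding fps_cong_def
  proof
    fix n
    have "d * fps_nth h n = fps_nth (h oo G) n - fps_nth (h oo fps_X) n"
      by (simp add: conj d_def algebra_simps)
    also have "\<dots> = (\<Sum>k=0..n. fps_nth h k * (fps_nth (G ^ k) n - fps_nth (fps_X ^ k) n))"
      unfolding fps_compose_nth by (simp add: right_diff_distrib flip: sum_subtractf)
    also have "\<dots> = (\<Sum>k=0..n. d * (fps_nth h k * fps_nth (of_nat k * fps_X ^ (k - 1) * ?B) n)
        + d\<^sup>2 * (fps_nth h k * fps_nth (R k) n))"
      unfolding Gk fps_add_nth fps_mult_left_const_nth by (intro sum.cong) (simp_all add: algebra_simps)
    also have "\<dots> = d * (\<Sum>k=0..n. fps_nth h k * fps_nth (of_nat k * fps_X ^ (k - 1) * ?B) n)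
        + d\<^sup>2 * (\<Sum>k=0..n. fps_nth h k * fps_nth (R k) n)"
      by (simp only: sum.distrib sum_distrib_left)
    also have "\<dots> = d * (fps_nth (V * (fps_X * fps_deriv h)) n + d * (\<Sum>k=0..n. fps_nth h k * fps_nth (R k) n))"
      unfolding deriv by (simp add: power2_eq_square algebra_simps)
    finally have "fps_nth h n = fps_nth (V * (fps_X * fps_deriv h)) n + d * (\<Sum>k=0..n. fps_nth h k * fps_nth (R k) n)"
      unfolding mult_left_cancel[OF d(1)] .
    then have "fps_nth h n - fps_nth (V * (fps_X * fps_deriv h)) n = (\<Sum>k=0..n. fps_nth h k * fps_nth (R k) n) * d"
      by (simp only: add_diff_cancel_left' mult.commute)
    also have "vabs \<dots> < 1"
      using h(1) R by (intro vabs_mult_less_1[OF _ d(2)] vabs_sum_le vabs_mult_le_1)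
        (auto simp: integral_fps_def)
    finally show "vabs (fps_nth h n - fps_nth (V * (fps_X * fps_deriv h)) n) < 1" .
  qed
  then show ?thesis
    using that V V_lim G_eq unfolding d_def by blast
qed

text \<open>
  The coefficients of the quotient are, up to units, the partial sums of \<open>V\<close> at \<open>a\<close>. They tend to
  the value of \<open>V\<close> at \<open>a\<close>, which is \<open>0\<close>.
\<close>

lemma fps_factor_root:
  fixes V :: "'a :: {ultrametric_field, complete_space} fps"
  assumes V: "integral_fps V" "fps_nth V \<longlonglongrightarrow> 0" and a: "vabs a = 1" "fps_value V a = 0"
  obtains S where "V = (fps_X - fps_const a) * S" "integral_fps S" "fps_nth S \<longlonglongrightarrow> 0"
proof -
  have a0: "a \<noteq> 0" using a(1) by auto
  define P where "P n = (\<Sum>j<n. fps_nth V j * a ^ j)" for n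
  define S where "S = Abs_fps (\<lambda>n. - P (Suc n) * inverse a ^ Suc n)"
  have "V = (fps_X - fps_const a) * S"
  proof (rule fps_ext)
    fix n
    have "a * fps_nth S k = - P (Suc k) * inverse a ^ k" for k
      using a0 by (simp add: S_def)
    moreover have "P 0 = 0" by (simp add: P_def)
    ultimately have "fps_nth ((fps_X - fps_const a) * S) n = (P (Suc n) - P n) * inverse a ^ n"
      by (cases n) (simp_all add: left_diff_distrib, simp add: S_def algebra_simps)
    also have "P (Suc n) - P n = fps_nth V n * a ^ n" by (simp add: P_def)
    finally show "fps_nth V n = fps_nth ((fps_X - fps_const a) * S) n"
      using a0 by (simp add: mult.assoc flip: power_mult_distrib)
  qed
  moreover have "integral_fps S"
  proof -
    have "vabs (P n) \<le> 1" for n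
      unfolding P_def using V(1) a(1)
      by (intro vabs_sum_le) (auto simp: integral_fps_def vabs_times vabs_power)
    then show ?thesis
      using a(1) unfolding integral_fps_def S_def by (simp add: vabs_times vabs_power vabs_inverse del: power_Suc)
  qed
  moreover have "fps_nth S \<longlonglongrightarrow> 0"
  proof -
    have "converges_at V a" using converges_at_unit_disk[OF V(2)] a(1) by simp
    then have "P \<longlonglongrightarrow> 0"
      using a(2) unfolding P_def converges_at_def fps_value_def by (metis summable_LIMSEQ)
    from tendsto_0_mult_bounded[OF tendsto_minus[OF LIMSEQ_Suc[OF this], simplified],
        of "\<lambda>n. inverse a ^ Suc n"]
    show ?thesis
      using a(1) by (simp add: S_def Abs_fps_inverse vabs_power vabs_inverse del: power_Suc)
  qed
  ultimately show ?thesis using that by blast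
qed

text \<open>
  Two distinct fixed points of \<open>G\<close> in the residue class of \<open>1\<close> are two zeros of \<open>V\<close>, hence a double
  zero modulo the maximal ideal.
\<close>

lemma linearizable_no_two_close_fixed_points:
  fixes G h :: "'a :: {ultrametric_field, complete_space} fps"
  assumes p: "prime p" "p \<ge> 3" "vabs (of_nat p :: 'a) = 1 / real p"
    and L: "vabs (\<Lambda> - 1) < 1" "\<Lambda> \<noteq> 1"
    and G: "fps_nth G 0 = 0" "fps_nth G \<longlonglongrightarrow> 0"
    and h: "integral_fps h" "fps_nth h 0 = 0" "fps_nth h 1 = 1"
    and conj: "h oo G = fps_const \<Lambda> * h"
    and fix1: "fps_value G 1 = 1" and fixz: "fps_value G z = z" and z: "vabs (z - 1) < 1"
  shows "z = 1"
proof (rule ccontr)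
  assume z1: "z \<noteq> 1"
  obtain V where V: "integral_fps V" "fps_nth V \<longlonglongrightarrow> 0"
    and G_eq: "G = fps_X + fps_const (\<Lambda> - 1) * (fps_X * V)"
    and cong: "fps_cong h (V * (fps_X * fps_deriv h))"
    using linearizable_infinitesimal_generator[OF L G h conj] by blast
  have vz: "vabs z = 1" by (rule vabs_eq_1_of_close_1[OF z])
  have zero: "fps_value V a = 0" if a: "vabs a = 1" "fps_value G a = a" for a
  proof -
    have Va: "converges_at V a" using converges_at_unit_disk[OF V(2)] a(1) by simp
    note XV = fps_value_mult[OF fps_value_X(1) Va]
    note dXV = fps_value_mult[OF fps_value_const(1) XV(1), of "\<Lambda> - 1"]
    have "fps_value G a = a + (\<Lambda> - 1) * (a * fps_value V a)"
      unfolding G_eq fps_value_add(2)[OF fps_value_X(1) dXV(1)] dXV(2) XV(2) by simp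
    then show ?thesis using a L(2) by auto
  qed
  obtain S1 where S1: "V = (fps_X - fps_const 1) * S1" "integral_fps S1" "fps_nth S1 \<longlonglongrightarrow> 0"
    using fps_factor_root[OF V, of 1] zero[OF _ fix1] by auto
  have S1z: "converges_at S1 z" using converges_at_unit_disk[OF S1(3)] vz by simp
  have Xz: "converges_at (fps_X - fps_const 1) z" "fps_value (fps_X - fps_const 1) z = z - 1"
  proof -
    have eq: "fps_X + fps_const (- 1) = fps_X - fps_const (1 :: 'a)" by simp
    note add = fps_value_add[OF fps_value_X(1) fps_value_const(1)[of "- 1"], of z,
        unfolded fps_value_X(2) fps_value_const(2) eq]
    show "converges_at (fps_X - fps_const 1) z" by (rule add(1))
    show "fps_value (fps_X - fps_const 1) z = z - 1" by (rule trans[OF add(2)]) simp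
  qed
  have "(z - 1) * fps_value S1 z = 0"
    using zero[OF vz fixz] unfolding S1(1) fps_value_mult(2)[OF Xz(1) S1z] Xz(2) .
  then have "fps_value S1 z = 0" using z1 by simp
  then obtain S where S: "S1 = (fps_X - fps_const z) * S" "integral_fps S" "fps_nth S \<longlonglongrightarrow> 0"
    using fps_factor_root[OF S1(2,3) vz] by blast
  have X1: "integral_fps (fps_X - 1 :: 'a fps)" by (intro integral_fps_diff integral_fps_X integral_fps_1)
  have Xz_int: "integral_fps (fps_X - fps_const z)"
    using vz by (intro integral_fps_diff integral_fps_X integral_fps_const) simp
  have "fps_cong (fps_X - fps_const z) (fps_X - 1)"
    using z by (auto simp: fps_cong_def vabs_diff_commute)
  then have "fps_cong ((fps_X - 1) * ((fps_X - fps_const z) * S)) ((fps_X - 1) * ((fps_X - 1) * S))"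
    by (intro fps_cong_mult fps_cong_refl integral_fps_mult X1 Xz_int S(2))
  then have "fps_cong V ((fps_X - 1)\<^sup>2 * S)"
    by (simp add: S1(1) S(1) power2_eq_square mult.assoc)
  then show False
    using no_double_zero[OF p V(1) _ S(2,3)] logarithmic_derivative_coeffs[OF p(1,3) h V(1) cong] by blast
qed

section \<open>Periodic points\<close>

definition fps_iterate :: "'a :: comm_ring_1 fps \<Rightarrow> nat \<Rightarrow> 'a fps" where
  "fps_iterate f m = ((\<lambda>g. f oo g) ^^ m) fps_X"

lemma fps_iterate_simps [simp]:
  "fps_iterate f 0 = fps_X" "fps_iterate f (Suc m) = f oo fps_iterate f m"
  by (simp_all add: fps_iterate_def)

lemma fps_iterate_integral:
  "integral_fps f \<Longrightarrow> integral_fps (fps_iterate f m)"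
  by (induction m) (auto intro: integral_fps_compose)

lemma fps_iterate_nth_0: "fps_nth f 0 = 0 \<Longrightarrow> fps_nth (fps_iterate f m) 0 = 0"
  by (induction m) auto

lemma linearization_iterate:
  fixes f H :: "'a :: field fps"
  assumes f: "fps_nth f 0 = 0" and conj: "H oo f = fps_const l * H"
  shows "H oo fps_iterate f m = fps_const (l ^ m) * H"
proof (induction m)
  case (Suc m)
  have "H oo fps_iterate f (Suc m) = (H oo f) oo fps_iterate f m"
    using f by (simp add: fps_compose_assoc fps_iterate_nth_0)
  also have "\<dots> = fps_const l * (H oo fps_iterate f m)"
    by (simp add: conj fps_const_mult_apply_left)
  finally show ?case by (simp add: Suc flip: mult.assoc)
qed simp

lemma fps_value_iterate:
  fixes f :: "'a :: {ultrametric_field, complete_space} fps"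
  assumes "integral_fps f" "fps_nth f 0 = 0" "vabs x < 1"
  shows "fps_value (fps_iterate f m) x = (fps_value f ^^ m) x"
  using assms
  by (induction m) (simp_all add: fps_value_compose fps_iterate_integral fps_iterate_nth_0)

lemma fps_value_minus_linear_le:
  fixes f :: "'a :: {ultrametric_field, complete_space} fps"
  assumes f: "integral_fps f" "fps_nth f 0 = 0" and x: "vabs x < 1"
  shows "vabs (fps_value f x - fps_nth f 1 * x) \<le> vabs x ^ 2"
proof -
  let ?l = "fps_const (- fps_nth f 1) * fps_X"
  note l = fps_value_mult[OF fps_value_const(1)[of "- fps_nth f 1"] fps_value_X(1), of x]
  note fl = fps_value_add[OF converges_at_integral[OF f(1) x] l(1)]
  have "vabs (fps_value (f + ?l) x) \<le> vabs x ^ 2"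
  proof (rule vabs_fps_value_le[OF fl(1)])
    fix n
    show "vabs (fps_nth (f + ?l) n) * vabs x ^ n \<le> vabs x ^ 2"
    proof (cases "n < 2")
      case True
      then have "n = 0 \<or> n = 1" by auto
      then show ?thesis using f(2) by auto
    next
      case False
      then have "vabs (fps_nth (f + ?l) n) * vabs x ^ n \<le> 1 * vabs x ^ 2"
        using f(1) x by (intro mult_mono power_decreasing) (auto simp: integral_fps_def fps_X_def)
      then show ?thesis by simp
    qed
  qed
  then show ?thesis
    unfolding fl(2) l(2) fps_value_const(2) fps_value_X(2) by simp
qed

text \<open>
  For \<open>\<bar>x\<bar> < \<bar>\<lambda> - 1\<bar>\<close> the linear part of \<open>f\<close> dominates the rest, so \<open>f x\<close> differs from \<open>x\<close>, but by
  less than \<open>\<bar>x\<bar>\<close>. If \<open>x\<close> has period \<open>m\<close>, then so has \<open>f x\<close>, and division by \<open>x\<close> turns the two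
  points into distinct fixed points of the rescaled iterate in the residue class of \<open>1\<close>.
\<close>

lemma no_periodic_point_on_circle:
  fixes f H :: "'a :: {ultrametric_field, complete_space} fps"
  assumes p: "prime p" "p \<ge> 3" "vabs (of_nat p :: 'a) = 1 / real p"
    and f: "fps_nth f 0 = 0" "integral_fps f"
    and lam: "vabs (fps_nth f 1 - 1) < 1" "\<And>n. n \<ge> 1 \<Longrightarrow> fps_nth f 1 ^ n \<noteq> 1"
    and H: "is_linearization f H"
    and x: "x \<noteq> 0" "vabs x < vabs (fps_nth f 1 - 1)"
    and bound: "\<And>n. vabs (fps_nth H (Suc n)) * vabs x ^ n \<le> 1"
  shows "\<not> periodic_point f x"
proof
  assume "periodic_point f x"
  then obtain m where m: "m \<ge> 1" "(fps_value f ^^ m) x = x" unfolding periodic_point_def by blast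
  define l where "l = fps_nth f 1"
  define y where "y = fps_value f x"
  define z where "z = y / x"
  have x1: "vabs x < 1" using x lam by linarith
  have quad: "vabs (y - l * x) \<le> vabs x ^ 2"
    unfolding y_def l_def by (rule fps_value_minus_linear_le[OF f(2,1) x1])
  have sq: "vabs x ^ 2 < vabs (l - 1) * vabs x"
    using x by (simp add: power2_eq_square l_def)
  have "y \<noteq> x"
  proof
    assume "y = x"
    then have "vabs (y - l * x) = vabs (l - 1) * vabs x"
      by (metis left_diff_distrib mult_1 vabs_diff_commute vabs_times)
    then show False using quad sq by linarith
  qed
  then have z1: "z \<noteq> 1" using x(1) by (simp add: z_def)
  have "vabs (l - 1) * vabs x < vabs x" using lam(1) x(1) by (simp add: l_def)
  then have "vabs ((y - l * x) + (l - 1) * x) < vabs x"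
    using quad sq by (intro vabs_add_less) (auto simp: vabs_times)
  then have yx: "vabs (y - x) < vabs x" by (simp add: algebra_simps)
  have "z - 1 = (y - x) / x" using x(1) by (simp add: z_def diff_divide_distrib)
  then have zc: "vabs (z - 1) < 1" using yx x(1) by (simp add: vabs_divide)
  have y1: "vabs y < 1"
    using vabs_eq_of_close[OF yx] x1 by simp
  let ?it = "fps_iterate f m"
  have it: "integral_fps ?it" "fps_nth ?it 0 = 0"
    using f by (simp_all add: fps_iterate_integral fps_iterate_nth_0)
  define G h where "G = rescale x ?it" and "h = rescale x H"
  have H01: "fps_nth H 0 = 0" "fps_nth H 1 = 1" and Hf: "H oo f = fps_const l * H"
    using H by (auto simp: is_linearization_def l_def)
  have h: "integral_fps h" "fps_nth h 0 = 0" "fps_nth h 1 = 1"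
  proof -
    have "vabs (fps_nth h n) \<le> 1" for n
      using bound[of "n - 1"] H01(1) x(1)
      by (cases n) (auto simp: h_def vabs_times vabs_divide vabs_power mult.assoc[symmetric])
    then show "integral_fps h" by (simp add: integral_fps_def)
  qed (use H01 x in \<open>simp_all add: h_def\<close>)
  have conj: "h oo G = fps_const (l ^ m) * h"
    unfolding h_def G_def using x(1) it(2) linearization_iterate[OF f(1) Hf, of m]
    by (simp add: rescale_mult_const flip: rescale_compose)
  have G0: "fps_nth G 0 = 0" using it(2) by (simp add: G_def)
  have G_lim: "fps_nth G \<longlonglongrightarrow> 0"
  proof -
    have "converges_at ?it x" by (rule converges_at_integral[OF it(1) x1])
    then have "converges_at G 1" using fps_value_rescale(1)[OF x(1), of ?it 1] by (simp add: G_def)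
    then show ?thesis by (simp add: converges_at_iff)
  qed
  have G_val: "fps_value G w = (fps_value f ^^ m) (x * w) / x" if "vabs (x * w) < 1" for w
    unfolding G_def
    using fps_value_rescale(2)[OF x(1) converges_at_integral[OF it(1) that]] fps_value_iterate[OF f(2,1) that]
    by simp
  have "fps_value G 1 = 1" using G_val[of 1] x1 m(2) x(1) by simp
  moreover have "fps_value G z = z"
  proof -
    have xz: "x * z = y" using x(1) by (simp add: z_def)
    have "(fps_value f ^^ m) y = y"
      unfolding y_def by (metis m(2) funpow_swap1)
    then show ?thesis using G_val[of z] y1 unfolding xz by (simp add: z_def)
  qed
  moreover have "vabs (l ^ m - 1) < 1"
    using vabs_power_minus_1_le[of l m] vabs_eq_1_of_close_1[of l] lam(1) by (simp add: l_def)
  moreover have "l ^ m \<noteq> 1" using lam(2)[OF m(1)] by (simp add: l_def)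
  ultimately have "z = 1"
    using linearizable_no_two_close_fixed_points[OF p _ _ G0 G_lim h conj _ _ zc] by blast
  then show False using z1 by simp
qed

section \<open>The boundary of the linearization disk\<close>

lemma vabs_of_nat_p:
  assumes "is_padic_complex p TYPE('a :: {ultrametric_field, complete_space})"
  shows "vabs (of_nat p :: 'a) = 1 / real p"
proof -
  have p: "prime p" and v: "vabs (of_rat (of_nat p) :: 'a) = padic_abs p (of_nat p)"
    using assms unfolding is_padic_complex_def by blast+
  have "quotient_of (of_nat p) = (int p, 1)"
    using quotient_of_int[of "int p"] by simp
  moreover have "multiplicity (int p) (int p) = 1"
    using prime_gt_1_nat[OF p] by (intro multiplicity_self) auto
  ultimately have "padic_abs p (of_nat p) = 1 / real p"
    using prime_gt_0_nat[OF p] by (simp add: padic_abs_def power_int_minus field_simps)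
  then show ?thesis using v by simp
qed

theorem corollary1p0p1:
  fixes p :: nat and lam :: "'a :: {ultrametric_field, complete_space}" and f :: "'a fps"
  assumes Cp: "is_padic_complex p TYPE('a)"
    and p: "prime p" "p \<ge> 3"
    and not_root_of_unity: "\<not> (\<exists>n\<ge>1. lam ^ n = 1)"
    and lam: "1 / real p < vabs (1 - lam)" "vabs (1 - lam) < 1"
    and f: "fps_nth f 0 = 0" "fps_nth f 1 = lam" "\<And>i. fps_nth f i \<in> integer_ring"
    and a2: "vabs (fps_nth f 2) = 1"
    and a3: "vabs ((fps_nth f 2)\<^sup>2 - fps_nth f 3) = 1"
  shows "\<forall>x \<in> linearization_boundary f. \<not> periodic_point f x"
proof
  fix x assume x: "x \<in> linearization_boundary f"
  let ?H = "linearization f"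
  define e where "e = vabs (fps_nth f 1 - 1)"
  define D where "D = linearization_disk f"
  have e: "1 / real p < e" "e < 1" "0 < e"
    using lam p(2) unfolding e_def f(2) vabs_diff_commute[of lam 1]
    by (auto intro: less_trans[rotated])
  have vp: "vabs (of_nat p :: 'a) = 1 / real p" by (rule vabs_of_nat_p[OF Cp])
  obtain L :: "'a set" where L: "is_algebraic_closure rat_completion L" "closure L = UNIV"
    using Cp unfolding is_padic_complex_def by blast
  have fint: "integral_fps f" using f(3) by (simp add: integral_fps_def integer_ring_def)
  have nr: "fps_nth f 1 ^ n \<noteq> 1" if "n \<ge> 1" for n
    using not_root_of_unity that f(2) by auto
  have "fps_nth f 1 \<noteq> 0" using lam(2) f(2) by auto
  then have H: "is_linearization f ?H"
    unfolding linearization_def using theI'[OF ex1_linearization[OF f(1) _ nr]] by blast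
  have coeff: "vabs (fps_nth ?H (Suc n)) * vabs y ^ n \<le> 1" if "y \<in> D" for y n
    using that linearization_coeff_le_on_disk[OF L H] unfolding D_def linearization_disk_def by blast
  define b where "b = vabs (fps_nth ?H (Suc p))"
  have b: "(1 / e) ^ p < b"
    unfolding e_def b_def
    using vabs_linearization_coeff_p_gt[OF p vp f(1) fint a2 a3 _ _ nr[of p] H] e(1,2) p(2)
    unfolding e_def by simp
  have b0: "b > 0" using b e by (meson less_trans zero_less_divide_1_iff zero_less_power)
  \<comment> \<open>The bound on the coefficient of degree \<open>p + 1\<close> confines the disk to radius \<open>s\<close>.\<close>
  define s where "s = root p (1 / b)"
  have s: "s < e"
  proof -
    have "1 / b < e ^ p" using b b0 e by (simp add: power_divide field_simps)
    then have "s < root p (e ^ p)" unfolding s_def using p(2) by (intro real_root_less_mono) auto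
    also have "\<dots> = e" using p(2) e(3) by (intro real_root_power_cancel) auto
    finally show ?thesis .
  qed
  have D_le: "vabs y \<le> s" if "y \<in> D" for y
  proof -
    have "vabs y ^ p \<le> 1 / b" using coeff[OF that, of p] b0 by (simp add: b_def field_simps)
    then have "root p (vabs y ^ p) \<le> s" unfolding s_def using p(2) by (intro real_root_le_mono) auto
    then show ?thesis using p(2) by (simp add: real_root_power_cancel)
  qed
  then have bdd: "bdd_above (vabs ` D)" by (intro bdd_aboveI[of _ s]) auto
  define r where "r = linearization_radius f"
  have r: "r = (SUP y\<in>D. vabs y)" by (simp add: r_def linearization_radius_def D_def)
  obtain A where A: "A \<ge> 1" "\<And>n. vabs (fps_nth ?H (Suc n)) \<le> A ^ n"
    using linearization_coeff_exponential_bound[OF p vp f(1) fint _ nr H] e(2) unfolding e_def by blast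
  obtain y where y: "y \<in> D" "y \<noteq> 0"
  proof -
    obtain k where k: "(1 / real p) ^ k < 1 / A"
      using real_arch_pow_inv[of "1 / A" "1 / real p"] A(1) p(2) by auto
    define c where "c = (of_nat p :: 'a) ^ k"
    have c: "vabs c = (1 / real p) ^ k" by (simp add: c_def vabs_power vp)
    have c0: "c \<noteq> 0" "vabs c \<le> 1" using p(2) by (auto simp: c_def vabs_power vp power_le_one)
    have Ac: "A * vabs c \<le> 1" using k A(1) by (simp add: c field_simps)
    have "vabs (fps_nth ?H (Suc n)) * vabs c ^ n \<le> 1" for n
    proof -
      have "vabs (fps_nth ?H (Suc n)) * vabs c ^ n \<le> A ^ n * vabs c ^ n"
        using A(2) by (intro mult_right_mono) auto
      also have "\<dots> = (A * vabs c) ^ n" by (simp add: power_mult_distrib)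
      also have "\<dots> \<le> 1" using Ac A(1) by (intro power_le_one) auto
      finally show ?thesis .
    qed
    then have "conjugate_to_linear_on f (ball 0 (vabs c))"
      by (rule conjugate_to_linear_on_ball[OF f(1) fint H c0])
    moreover have "disk_about_zero (ball (0 :: 'a) (vabs c))"
      using c0(1) unfolding disk_about_zero_def by (intro exI[of _ "vabs c"]) auto
    ultimately have "ball 0 (vabs c) \<subseteq> D"
      unfolding D_def by (intro linearization_disk_greatest)
    moreover have "vabs (of_nat p * c) < vabs c"
      using c0(1) p(2) mult_strict_left_mono[of "1 / real p" 1 "vabs c"]
      by (simp add: vabs_times vp mult.commute)
    then have "of_nat p * c \<in> ball 0 (vabs c)" by (simp add: dist_vabs)
    ultimately show ?thesis using that[of "of_nat p * c"] c0(1) p(2) by auto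
  qed
  have r_pos: "r > 0"
    using cSUP_upper[OF y(1) bdd] y(2) unfolding r by (metis less_le_trans vabs_pos_iff)
  have r_le: "r \<le> s"
    unfolding r using y(1) D_le by (intro cSUP_least) auto
  have vx: "vabs x = r" using x by (simp add: linearization_boundary_def r_def)
  \<comment> \<open>The radius \<open>r\<close> is a limit from below of numbers exceeded by absolute values on the disk.\<close>
  have bound: "vabs (fps_nth ?H (Suc n)) * vabs x ^ n \<le> 1" for n
  proof -
    have "vabs (fps_nth ?H (Suc n)) * (r * (1 + - inverse (real (Suc k)))) ^ n \<le> 1" for k
    proof -
      let ?t = "r * (1 + - inverse (real (Suc k)))"
      have t0: "0 \<le> ?t" using r_pos by (intro mult_nonneg_nonneg) (auto simp: field_simps)
      have "r * (1 + - inverse (real (Suc k))) < r * 1"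
        using r_pos by (intro mult_strict_left_mono) auto
      then obtain w where w: "w \<in> D" "?t < vabs w"
        using less_cSUP_iff[OF _ bdd, of ?t] y(1) unfolding r by auto
      have "vabs (fps_nth ?H (Suc n)) * ?t ^ n \<le> vabs (fps_nth ?H (Suc n)) * vabs w ^ n"
        using t0 w(2) by (intro mult_left_mono power_mono) auto
      also have "\<dots> \<le> 1" by (rule coeff[OF w(1)])
      finally show ?thesis .
    qed
    moreover have "(\<lambda>k. vabs (fps_nth ?H (Suc n)) * (r * (1 + - inverse (real (Suc k)))) ^ n)
        \<longlonglongrightarrow> vabs (fps_nth ?H (Suc n)) * r ^ n"
      by (intro tendsto_intros LIMSEQ_inverse_real_of_nat_add_minus_mult)
    ultimately show ?thesis unfolding vx by (intro LIMSEQ_le_const2) auto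
  qed
  show "\<not> periodic_point f x"
  proof (rule no_periodic_point_on_circle[OF p vp f(1) fint _ nr H _ _ bound])
    show "vabs (fps_nth f 1 - 1) < 1" using e(2) by (simp add: e_def)
    show "x \<noteq> 0" using vx r_pos by auto
    show "vabs x < vabs (fps_nth f 1 - 1)" using vx r_le s by (simp add: e_def)
  qed
qed

end
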